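(* Assume $s<d$; $A$ is symmetric, continuous on $\overline{(\Omega\cup\Omega_\delta)^2}$, satisfies $0<r\le A\le R<\infty$, and $A(\mathbf x,\cdot)\in C^4$; $a(\mathbf x):=A(\mathbf x,\mathbf x)$ satisfies $a\in C^\infty(\Omega)$; $\Omega$ is bounded and $\Omega\cup\Omega_\delta$ is a $C^1$ domain. Let $u^\delta$ solve $-\mathcal L^\delta[u^\delta]=f$ in $\Omega$, $u^\delta=u^D$ on $\Omega_\delta$, let $u^0$ solve $-\nabla\cdot(a\nabla u^0)=f$ in $\Omega$, $u^0=u^D$ on $\partial\Omega$ (with $u^0:=u^D$ on $\Omega_\delta$), and assume $u^\delta,u^0\in C^4(\Omega)$ (and $C^4$ as functions on $\Omega\cup\Omega_\delta$). Then there exists $\delta_0>0$ such that for any $0<\delta<\delta_0$ and fixed ratio $h/\delta<C_{pos}$, the numerical solution $u_h^\delta$ of the discretized nonlocal problem satisfies $$\|u_h^\delta-u^\delta\|_{L^\infty(\chi_h)}\le C\delta^2 .$$ Moreover, the scheme is asymptotically compatible: $$\|u_h^\delta-u^0\|_{L^\infty(\chi_h)}\le C\delta^2,$$ where $C$ is a constant independent of $\delta$.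
   Context: $\Omega\subset\mathbb R^d$ ($d\ge1$) is a bounded Lipschitz domain; $\Omega_\delta=\{\mathbf x\in\mathbb R^d\setminus\Omega:\mathrm{dist}(\mathbf x,\partial\Omega)<\delta\}$; $B_\delta(\mathbf x)=\{\mathbf y:|\mathbf y-\mathbf x|<\delta\}$. $A$, $f$ are fixed, independent of $\delta$. Kernel: $\gamma_\delta(|\mathbf x-\mathbf y|)=\frac1{\delta^{d+2}}\gamma_1\!\left(\frac{|\mathbf x-\mathbf y|}{\delta}\right)$, equal to $\frac{D_0}{\delta^{d+2-s}|\mathbf x-\mathbf y|^s}$ for $|\mathbf x-\mathbf y|<\delta$ and $0$ otherwise ($D_0>0$), where $\gamma_1$ is nonnegative, nonincreasing, has a singularity of order $s$ at the origin, $\mathrm{supp}(\gamma_1)\subset B_1(\mathbf 0)$ and $\int_{B_1(\mathbf 0)}\gamma_1(|\mathbf z|)|\mathbf z|^2d\mathbf z=d$. $\mathcal L^\delta[u](\mathbf x)=2\int_{B_\delta(\mathbf x)}A(\mathbf x,\mathbf y)\gamma_\delta(|\mathbf x-\mathbf y|)(u(\mathbf y)-u(\mathbf x))\,d\mathbf y$. Grid: $\chi_h=\{(k_{(1)}h,\dots,k_{(d)}h):\mathbf k\in\mathbb Z^d\}\cap(\Omega\cup\Omega_\delta)=\{\mathbf x_i\}$. For each $\mathbf x_i\in\chi_h\cap\Omega$ the quadrature weights $\{\omega_{j,i}\}$, indexed by $\mathbf x_j\in\chi_h\cap B_\delta(\mathbf x_i)\setminus\{\mathbf x_i\}$, minimize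 $\sum_j\frac12\omega_{j,i}^2\,\gamma_\delta(|\mathbf x_j-\mathbf x_i|)$ subject to $\sum_j q(\mathbf x_i,\mathbf x_j)\omega_{j,i}=\int_{B_\delta(\mathbf x_i)}q(\mathbf x_i,\mathbf y)\,d\mathbf y$ for all $q(\mathbf x,\mathbf y)=p(\mathbf y-\mathbf x)\gamma_\delta(|\mathbf x-\mathbf y|)$ with $p$ a polynomial on $\mathbb R^d$ of degree at most $3$. Discrete operator: $(\mathcal L_h^\delta u)(\mathbf x_i)=2\sum_{\mathbf x_j\in\chi_h\cap B_\delta(\mathbf x_i)\setminus\{\mathbf x_i\}}A(\mathbf x_i,\mathbf x_j)\gamma_\delta(|\mathbf x_i-\mathbf x_j|)(u(\mathbf x_j)-u(\mathbf x_i))\omega_{j,i}$. Discretized problem: $-(\mathcal L_h^\delta u_h^\delta)(\mathbf x_i)=f(\mathbf x_i)$ for $\mathbf x_i\in\chi_h\cap\Omega$, $u_h^\delta(\mathbf x_i)=u^D(\mathbf x_i)$ for $\mathbf x_i\in\chi_h\cap\Omega_\delta$. $C_{pos}>0$ is a constant, independent of $\delta$ and $h$, such that for all $h<C_{pos}\delta$ the weight optimization problem is solvable (grid unisolvent) and all $\omega_{j,i}>0$. $\|v\|_{L^\infty(\chi_h)}=\max_{\mathbf x_i\in\chi_h}|v(\mathbf x_i)|$. Regularity classes $C^k$ of functions in $\Omega\cup\Omega_\delta$ are understood with bounded derivatives (uniformly in any other variable). *)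

theory Defs
  imports "HOL-Analysis.Analysis"
begin

section \<open>Classes of differentiable functions\<close>

definition partial_deriv :: "'n::finite \<Rightarrow> (real^'n \<Rightarrow> real) \<Rightarrow> real^'n \<Rightarrow> real" where
  "partial_deriv i f x = frechet_derivative f (at x) (axis i 1)"

text \<open>Iterated partial derivatives are indexed by lists of coordinates: the list \<open>[i, j]\<close> stands
  for the partial derivative in direction \<open>i\<close> of the one in direction \<open>j\<close>. The class is meant for
  open sets only; asking for Frechet differentiability (not only existence of partial
  derivatives) below the top order costs nothing there and makes \<^const>\<open>frechet_derivative\<close>
  meaningful.\<close>

definition Ck_on :: "nat \<Rightarrow> (real^'n::finite) set \<Rightarrow> (real^'n \<Rightarrow> real) \<Rightarrow> bool" where
  "Ck_on k S f \<longleftrightarrow>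
     (\<forall>js. length js < k \<longrightarrow> (\<forall>x\<in>S. foldr partial_deriv js f differentiable (at x))) \<and>
     (\<forall>js. length js \<le> k \<longrightarrow> continuous_on S (foldr partial_deriv js f))"

definition smooth_on :: "(real^'n::finite) set \<Rightarrow> (real^'n \<Rightarrow> real) \<Rightarrow> bool" where
  "smooth_on S f \<longleftrightarrow> (\<forall>k. Ck_on k S f)"

text \<open>The bound \<open>M\<close> is an explicit argument so that uniformity in a parameter can be expressed.\<close>

definition Ck_bounded_on ::
    "nat \<Rightarrow> (real^'n::finite) set \<Rightarrow> real \<Rightarrow> (real^'n \<Rightarrow> real) \<Rightarrow> bool" where
  "Ck_bounded_on k S M f \<longleftrightarrow>
     Ck_on k S f \<and> (\<forall>js. length js \<le> k \<longrightarrow> (\<forall>x\<in>S. \<bar>foldr partial_deriv js f x\<bar> \<le> M))"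

section \<open>Domains\<close>

text \<open>Near each boundary point the domain is, after a rotation taking the last coordinate axis to
  the unit vector \<open>e\<close>, the region above the graph of a function \<open>\<phi>\<close> on the hyperplane orthogonal
  to \<open>e\<close>. The function \<open>\<phi>\<close> is total on the whole space but evaluated on that hyperplane only;
  a Lipschitz or continuously differentiable function on the hyperplane extends to one of the
  same class by composing with the orthogonal projection. In dimension one the hyperplane is
  \<open>{0}\<close> and the domain is an interval.\<close>

definition graph_domain :: "((real^'n::finite \<Rightarrow> real) \<Rightarrow> bool) \<Rightarrow> (real^'n) set \<Rightarrow> bool" where
  "graph_domain P \<Omega> \<longleftrightarrow> open \<Omega> \<and> connected \<Omega> \<and> \<Omega> \<noteq> {} \<and>
     (\<forall>p\<in>frontier \<Omega>. \<exists>e \<phi> \<rho>. norm e = 1 \<and> 0 < \<rho> \<and> P \<phi> \<and>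
        \<Omega> \<inter> ball p \<rho> = {x \<in> ball p \<rho>. \<phi> (x - (x \<bullet> e) *\<^sub>R e) < x \<bullet> e})"

definition Lipschitz_domain :: "(real^'n::finite) set \<Rightarrow> bool" where
  "Lipschitz_domain \<Omega> \<longleftrightarrow> graph_domain (\<lambda>\<phi>. \<exists>L. L-lipschitz_on UNIV \<phi>) \<Omega>"

definition C1_domain :: "(real^'n::finite) set \<Rightarrow> bool" where
  "C1_domain \<Omega> \<longleftrightarrow> graph_domain (Ck_on 1 UNIV) \<Omega>"

text \<open>The interaction layer contains the boundary of the domain, so that the union of a domain
  and its layer is an open set.\<close>

definition layer :: "(real^'n::finite) set \<Rightarrow> real \<Rightarrow> (real^'n) set" where
  "layer \<Omega> \<delta> = {x. x \<notin> \<Omega> \<and> infdist x (frontier \<Omega>) < \<delta>}"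

section \<open>Nonlocal and local operators\<close>

definition scaled_kernel :: "nat \<Rightarrow> (real \<Rightarrow> real) \<Rightarrow> real \<Rightarrow> real \<Rightarrow> real" where
  "scaled_kernel d \<gamma>\<^sub>1 \<delta> r = 1 / \<delta> ^ (d + 2) * \<gamma>\<^sub>1 (r / \<delta>)"

definition nonlocal_op ::
    "(real^'n::finite \<Rightarrow> real^'n \<Rightarrow> real) \<Rightarrow> (real \<Rightarrow> real) \<Rightarrow> real \<Rightarrow>
     (real^'n \<Rightarrow> real) \<Rightarrow> real^'n \<Rightarrow> real" where
  "nonlocal_op A \<gamma>\<^sub>1 \<delta> u x =
     2 * (LINT y:ball x \<delta>|lborel.
            A x y * scaled_kernel CARD('n) \<gamma>\<^sub>1 \<delta> (norm (x - y)) * (u y - u x))"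

definition local_op ::
    "(real^'n::finite \<Rightarrow> real) \<Rightarrow> (real^'n \<Rightarrow> real) \<Rightarrow> real^'n \<Rightarrow> real" where
  "local_op a u x = (\<Sum>i\<in>UNIV. partial_deriv i (\<lambda>y. a y * partial_deriv i u y) x)"

section \<open>Meshfree discretization\<close>

definition grid :: "(real^'n::finite) set \<Rightarrow> real \<Rightarrow> real \<Rightarrow> (real^'n) set" where
  "grid \<Omega> \<delta> h = {x. \<exists>k :: 'n \<Rightarrow> int. x = (\<chi> i. of_int (k i) * h)} \<inter> (\<Omega> \<union> layer \<Omega> \<delta>)"

definition stencil :: "(real^'n::finite) set \<Rightarrow> real \<Rightarrow> real^'n \<Rightarrow> (real^'n) set" where
  "stencil X \<delta> x = (X \<inter> ball x \<delta>) - {x}"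

definition polynomial_deg_le :: "nat \<Rightarrow> (real^'n::finite \<Rightarrow> real) \<Rightarrow> bool" where
  "polynomial_deg_le k p \<longleftrightarrow>
     (\<exists>c. p = (\<lambda>z. \<Sum>\<alpha> | (\<Sum>i\<in>UNIV. \<alpha> i) \<le> k. c \<alpha> * (\<Prod>i\<in>UNIV. (z $ i) ^ \<alpha> i)))"

text \<open>The sum over multi-indices is a genuine finite sum.\<close>

lemma finite_multi_indices: "finite {\<alpha> :: 'n::finite \<Rightarrow> nat. (\<Sum>i\<in>UNIV. \<alpha> i) \<le> k}"
proof (rule finite_subset)
  have "\<alpha> i \<le> k" if "(\<Sum>i\<in>UNIV. \<alpha> i) \<le> k" for \<alpha> :: "'n \<Rightarrow> nat" and i
    using that member_le_sum[of i UNIV \<alpha>] by simp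
  then show "{\<alpha> :: 'n \<Rightarrow> nat. (\<Sum>i\<in>UNIV. \<alpha> i) \<le> k} \<subseteq> PiE UNIV (\<lambda>_. {..k})"
    by (auto simp: PiE_def)
  show "finite (PiE UNIV (\<lambda>_. {..k}) :: ('n \<Rightarrow> nat) set)"
    by (intro finite_PiE) auto
qed

text \<open>Here \<open>w y\<close> is the weight of the neighbour \<open>y\<close> of a fixed centre \<open>x\<close>; values of \<open>w\<close> outside
  the stencil are irrelevant.\<close>

definition exact_quadrature ::
    "(real \<Rightarrow> real) \<Rightarrow> (real^'n::finite) set \<Rightarrow> real \<Rightarrow> real^'n \<Rightarrow> (real^'n \<Rightarrow> real) \<Rightarrow> bool" where
  "exact_quadrature \<gamma>\<^sub>1 X \<delta> x w \<longleftrightarrow>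
     (\<forall>p. polynomial_deg_le 3 p \<longrightarrow>
        (\<Sum>y\<in>stencil X \<delta> x. p (y - x) * scaled_kernel CARD('n) \<gamma>\<^sub>1 \<delta> (norm (x - y)) * w y) =
        (LINT y:ball x \<delta>|lborel. p (y - x) * scaled_kernel CARD('n) \<gamma>\<^sub>1 \<delta> (norm (x - y))))"

definition quadrature_cost ::
    "(real \<Rightarrow> real) \<Rightarrow> (real^'n::finite) set \<Rightarrow> real \<Rightarrow> real^'n \<Rightarrow> (real^'n \<Rightarrow> real) \<Rightarrow> real" where
  "quadrature_cost \<gamma>\<^sub>1 X \<delta> x w =
     (\<Sum>y\<in>stencil X \<delta> x. 1 / 2 * (w y)\<^sup>2 * scaled_kernel CARD('n) \<gamma>\<^sub>1 \<delta> (norm (y - x)))"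

definition quadrature_weights ::
    "(real \<Rightarrow> real) \<Rightarrow> (real^'n::finite) set \<Rightarrow> real \<Rightarrow> real^'n \<Rightarrow> (real^'n \<Rightarrow> real) \<Rightarrow> bool" where
  "quadrature_weights \<gamma>\<^sub>1 X \<delta> x w \<longleftrightarrow>
     exact_quadrature \<gamma>\<^sub>1 X \<delta> x w \<and>
     (\<forall>w'. exact_quadrature \<gamma>\<^sub>1 X \<delta> x w' \<longrightarrow>
           quadrature_cost \<gamma>\<^sub>1 X \<delta> x w \<le> quadrature_cost \<gamma>\<^sub>1 X \<delta> x w')"

text \<open>\<open>\<omega> x y\<close> is the weight of the neighbour \<open>y\<close> of the centre \<open>x\<close>.\<close>

definition discrete_op ::
    "(real^'n::finite \<Rightarrow> real^'n \<Rightarrow> real) \<Rightarrow> (real \<Rightarrow> real) \<Rightarrow> (real^'n) set \<Rightarrow> real \<Rightarrow>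
     (real^'n \<Rightarrow> real^'n \<Rightarrow> real) \<Rightarrow> (real^'n \<Rightarrow> real) \<Rightarrow> real^'n \<Rightarrow> real" where
  "discrete_op A \<gamma>\<^sub>1 X \<delta> \<omega> u x =
     2 * (\<Sum>y\<in>stencil X \<delta> x.
            A x y * scaled_kernel CARD('n) \<gamma>\<^sub>1 \<delta> (norm (x - y)) * (u y - u x) * \<omega> x y)"

definition grid_norm :: "(real^'n::finite) set \<Rightarrow> (real^'n \<Rightarrow> real) \<Rightarrow> real" where
  "grid_norm X v = Max ((\<lambda>x. \<bar>v x\<bar>) ` X)"

end

theory Submission
  imports Defs "HOL-Combinatorics.Transposition"
begin

text \<open>The nonlocal operator and its discretization both have the form
  \<open>2 * (\<integral>y. A x y * (v y - v x) \<partial>\<mu> x)\<close> for a positive measure \<open>\<mu> x\<close> on the ball of radius \<open>\<delta>\<close>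
  whose moments up to order three are those of the rescaled kernel; for the quadrature rule this is
  exactness on cubics together with positivity of the weights. A Taylor expansion then shows that
  each of them, applied to the local solution \<open>u\<^sub>0\<close>, reproduces the local operator up to
  \<open>O(\<delta>\<^sup>2)\<close>: the drift term is right because \<open>\<nabla>a(x) = 2 \<nabla>\<^sub>y A(x, y)\<close> at \<open>y = x\<close> by symmetry of
  \<open>A\<close>. A maximum principle with an exponential barrier turns this into
  \<open>u\<^sub>h - u\<^sub>0 = O(\<delta>\<^sup>2)\<close> and \<open>u\<^sup>\<delta> - u\<^sub>0 = O(\<delta>\<^sup>2)\<close>. Comparing everything with \<open>u\<^sub>0\<close> avoids any
  bound on the derivatives of \<open>u\<^sup>\<delta>\<close> that is uniform in \<open>\<delta>\<close>.\<close>

section \<open>Taylor expansion along iterated partial derivatives\<close>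

text \<open>One stability argument has to serve a finite grid and a continuum, so it is run on a set
  \<open>Y\<close> carrying the measures \<open>\<mu> x\<close>; compactness of
  \<open>Y \<inter> closure \<Omega>\<close> and continuity of the error there suffice to attain a
  maximum. The kernel may be singular of any order s < d, so its moments must be shown finite before
  symmetry can evaluate them: sign changes kill the odd and mixed moments, coordinate swaps equate
  the pure second moments, and the normalization makes each of them 1. At a point close to the
  boundary the Taylor expansion reaches into the layer; \<open>u\<^sub>0\<close> is C^4 there too
  and all solutions equal \<open>u\<^sub>D\<close> there, so the error vanishes off \<Omega> and no
  boundary layer term arises. For the constant to be independent of \<delta>, the bounds
  \<open>M\<close>, \<open>N\<close>, \<open>b\<close> are taken once, on a layer of fixed width,
  and the steepness \<open>l\<close> of the barrier depends only on \<open>M\<close>,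
  \<open>r\<close> and the dimension.\<close>

definition monomial :: "'n::finite list \<Rightarrow> real^'n \<Rightarrow> real" where
  "monomial js z = (\<Prod>j\<leftarrow>js. z $ j)"

text \<open>Ordered words take the place of multi-indices: differentiating along a line prepends one
  letter, so neither symmetry of mixed partials nor multinomial coefficients are ever used.\<close>

abbreviation words :: "nat \<Rightarrow> 'n::finite list set" where
  "words k \<equiv> {js. length js = k}"

abbreviation iter_deriv :: "'n::finite list \<Rightarrow> (real^'n \<Rightarrow> real) \<Rightarrow> real^'n \<Rightarrow> real" where
  "iter_deriv js f \<equiv> foldr partial_deriv js f"

text \<open>The homogeneous part of degree k of the Taylor polynomial at x, with increment z.
  Summing over all words counts each mixed partial with its multinomial multiplicity, which makes
  the single factor 1/k! correct.\<close>

definition taylor_form :: "nat \<Rightarrow> (real^'n::finite \<Rightarrow> real) \<Rightarrow> real^'n \<Rightarrow> real^'n \<Rightarrow> real" where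
  "taylor_form k f x z = (\<Sum>js\<in>words k. monomial js z * (iter_deriv js f x / fact k))"

lemma monomial_Nil [simp]: "monomial [] z = 1"
  and monomial_Cons [simp]: "monomial (j # js) z = z $ j * monomial js z"
  and monomial_append: "monomial (js @ ks) z = monomial js z * monomial ks z"
  by (simp_all add: monomial_def)

lemma abs_monomial_le: "\<bar>monomial js z\<bar> \<le> norm z ^ length js"
  by (induction js) (auto simp: abs_mult intro!: mult_mono component_le_norm_cart)

lemma continuous_on_monomial [continuous_intros]:
  "continuous_on S f \<Longrightarrow> continuous_on S (\<lambda>y. monomial js (f y))"
  by (induction js) (auto intro!: continuous_intros)

lemma finite_words [simp]: "finite (words k :: 'n::finite list set)"
  using finite_lists_length_eq[of "UNIV :: 'n set" k] by simp

lemma card_words: "card (words k :: 'n::finite list set) = CARD('n) ^ k"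
  using card_lists_length_eq[of "UNIV :: 'n set" k] by simp

lemma words_0: "words 0 = {[]}"
  by auto

lemma words_Suc: "words (Suc k) = (\<lambda>(j, js). j # js) ` (UNIV \<times> words k)"
  by (auto simp: length_Suc_conv)

lemma sum_words_Suc: "(\<Sum>js\<in>words (Suc k). g js) = (\<Sum>js\<in>words k. \<Sum>j\<in>UNIV. g (j # js))"
proof -
  have "(\<Sum>js\<in>words (Suc k). g js) = (\<Sum>(j, js)\<in>UNIV \<times> words k. g (j # js))"
    unfolding words_Suc by (subst sum.reindex) (auto simp: inj_on_def case_prod_unfold)
  also have "\<dots> = (\<Sum>j\<in>UNIV. \<Sum>js\<in>words k. g (j # js))"
    by (subst sum.cartesian_product) simp
  finally show ?thesis
    by (subst sum.swap)
qed

lemma sum_words_0: "(\<Sum>js\<in>words 0. g js) = g []"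
  by (simp add: words_0)

lemma sum_words_1: "(\<Sum>js\<in>words 1. g js) = (\<Sum>i\<in>UNIV. g [i])"
  using sum_words_Suc[of g 0] by (simp add: sum_words_0)

lemma sum_words_2: "(\<Sum>js\<in>words 2. g js) = (\<Sum>i\<in>UNIV. \<Sum>j\<in>UNIV. g [i, j])"
  using sum_words_Suc[of g 1] sum_words_1[of "\<lambda>js. \<Sum>i\<in>UNIV. g (i # js)"]
  by (simp add: numeral_2_eq_2) (rule sum.swap)

lemma frechet_derivative_eq_sum:
  fixes f :: "real^'n::finite \<Rightarrow> real"
  assumes "f differentiable (at x)"
  shows "frechet_derivative f (at x) z = (\<Sum>j\<in>UNIV. z $ j * partial_deriv j f x)"
proof -
  have "linear (frechet_derivative f (at x))"
    using assms linear_frechet_derivative by blast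
  moreover have "z = (\<Sum>j\<in>UNIV. z $ j *\<^sub>R axis j 1)"
    by (simp add: basis_expansion flip: scalar_mult_eq_scaleR)
  ultimately have "frechet_derivative f (at x) z =
      (\<Sum>j\<in>UNIV. frechet_derivative f (at x) (z $ j *\<^sub>R axis j 1))"
    by (metis linear_sum)
  then show ?thesis
    using \<open>linear _\<close> by (simp add: partial_deriv_def linear_cmul)
qed

lemma DERIV_along_line:
  fixes f :: "real^'n::finite \<Rightarrow> real"
  assumes "f differentiable (at (x + t *\<^sub>R z))"
  shows "((\<lambda>t. f (x + t *\<^sub>R z)) has_real_derivative
           (\<Sum>j\<in>UNIV. z $ j * partial_deriv j f (x + t *\<^sub>R z))) (at t)"
proof -
  have "(f has_derivative frechet_derivative f (at (x + t *\<^sub>R z))) (at (x + t *\<^sub>R z))"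
    using assms frechet_derivative_works by blast
  moreover have line: "((\<lambda>t. x + t *\<^sub>R z) has_derivative (\<lambda>s. s *\<^sub>R z)) (at t)"
    by (auto intro!: derivative_eq_intros)
  ultimately have "((\<lambda>t. f (x + t *\<^sub>R z)) has_derivative
      (\<lambda>s. frechet_derivative f (at (x + t *\<^sub>R z)) (s *\<^sub>R z))) (at t)"
    by (intro has_derivative_compose[OF line])
  moreover have "(\<lambda>s. frechet_derivative f (at (x + t *\<^sub>R z)) (s *\<^sub>R z)) =
      (*) (\<Sum>j\<in>UNIV. z $ j * partial_deriv j f (x + t *\<^sub>R z))"
    using frechet_derivative_eq_sum[OF assms]
    by (auto simp: sum_distrib_left sum_distrib_right fun_eq_iff mult_ac)
  ultimately show ?thesis
    by (simp add: has_field_derivative_def)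
qed

lemma Ck_bounded_on_subset: "Ck_bounded_on k S M f \<Longrightarrow> T \<subseteq> S \<Longrightarrow> Ck_bounded_on k T M f"
  unfolding Ck_bounded_on_def Ck_on_def by (meson continuous_on_subset subsetD)

lemma Ck_bounded_on_le: "Ck_bounded_on k S M f \<Longrightarrow> l \<le> k \<Longrightarrow> Ck_bounded_on l S M f"
  unfolding Ck_bounded_on_def Ck_on_def by (meson le_trans less_le_trans)

lemma Ck_bounded_onD:
  assumes "Ck_bounded_on k S M f"
  shows "length js < k \<Longrightarrow> x \<in> S \<Longrightarrow> iter_deriv js f differentiable (at x)"
    and "length js \<le> k \<Longrightarrow> continuous_on S (iter_deriv js f)"
    and "length js \<le> k \<Longrightarrow> x \<in> S \<Longrightarrow> \<bar>iter_deriv js f x\<bar> \<le> M"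
  using assms unfolding Ck_bounded_on_def Ck_on_def by blast+

text \<open>There are d^k words, each contributing at most M |z|^k; the factor 1/k! is given away,
  hence the quotient \<open>M / 1\<close> that \<open>frac_le\<close> produces.\<close>

lemma abs_taylor_form_le:
  fixes f :: "real^'n::finite \<Rightarrow> real"
  assumes "\<And>js. length js = k \<Longrightarrow> \<bar>iter_deriv js f x\<bar> \<le> M"
  shows "\<bar>taylor_form k f x z\<bar> \<le> real CARD('n) ^ k * M * norm z ^ k"
proof -
  have "0 \<le> M"
    using assms[of "replicate k undefined"] by simp
  have "\<bar>taylor_form k f x z\<bar> \<le> (\<Sum>js\<in>(words k :: 'n list set). norm z ^ k * (M / 1))"
    unfolding taylor_form_def
  proof (rule order_trans[OF sum_abs], rule sum_mono)
    fix js :: "'n list" assume js: "js \<in> words k"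
    have "\<bar>monomial js z * (iter_deriv js f x / fact k)\<bar> =
        \<bar>monomial js z\<bar> * (\<bar>iter_deriv js f x\<bar> / fact k)"
      by (simp add: abs_mult)
    also have "\<dots> \<le> norm z ^ k * (M / 1)"
      using abs_monomial_le[of js z] js assms[of js] \<open>0 \<le> M\<close>
      by (intro mult_mono frac_le fact_ge_1) auto
    finally show "\<bar>monomial js z * (iter_deriv js f x / fact k)\<bar> \<le> norm z ^ k * (M / 1)" .
  qed
  then show ?thesis
    by (simp add: card_words mult_ac)
qed

text \<open>Maclaurin's formula with Lagrange remainder for t -> f(x + t z) on [0, 1]:
  \<open>D k\<close> is the k-th derivative of this restriction, and the remainder is again a Taylor
  form, based at an intermediate point of the segment.\<close>

lemma taylor_bound:
  fixes f :: "real^'n::finite \<Rightarrow> real"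
  assumes f: "Ck_bounded_on n S M f" and S: "closed_segment x (x + z) \<subseteq> S" and "0 < n"
  shows "\<bar>f (x + z) - (\<Sum>k<n. taylor_form k f x z)\<bar> \<le> real CARD('n) ^ n * M * norm z ^ n"
proof -
  define D where "D k t = (\<Sum>js\<in>words k. monomial js z * iter_deriv js f (x + t *\<^sub>R z))" for k t
  have line: "x + t *\<^sub>R z \<in> S" if "0 \<le> t" "t \<le> 1" for t
    using S that by (auto simp: subset_iff closed_segment_def algebra_simps)
  have "(D k has_real_derivative D (Suc k) t) (at t)" if "k < n" "0 \<le> t" "t \<le> 1" for k t
  proof -
    have *: "((\<lambda>t. iter_deriv js f (x + t *\<^sub>R z)) has_real_derivative
        (\<Sum>j\<in>UNIV. z $ j * iter_deriv (j # js) f (x + t *\<^sub>R z))) (at t)" if "js \<in> words k" for js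
      using that line[of t] \<open>k < n\<close> \<open>0 \<le> t\<close> \<open>t \<le> 1\<close>
      by (auto intro!: DERIV_along_line Ck_bounded_onD(1)[OF f])
    have "(D k has_real_derivative (\<Sum>js\<in>words k. monomial js z *
        (\<Sum>j\<in>UNIV. z $ j * iter_deriv (j # js) f (x + t *\<^sub>R z)))) (at t)"
      unfolding D_def by (intro DERIV_sum DERIV_cmult *)
    moreover have "(\<Sum>js\<in>words k. monomial js z *
        (\<Sum>j\<in>UNIV. z $ j * iter_deriv (j # js) f (x + t *\<^sub>R z))) = D (Suc k) t"
      by (simp add: D_def sum_words_Suc sum_distrib_left mult_ac)
    ultimately show ?thesis
      by simp
  qed
  moreover have "D 0 = (\<lambda>t. f (x + t *\<^sub>R z))"
    by (simp add: D_def words_0 fun_eq_iff)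
  ultimately obtain t where t: "0 < t" "t < 1" and
    eq: "f (x + z) = (\<Sum>k<n. D k 0 / fact k) + D n t / fact n"
    using Maclaurin[of 1 n D "\<lambda>t. f (x + t *\<^sub>R z)"] \<open>0 < n\<close> by auto
  have "D k 0 / fact k = taylor_form k f x z" for k
    by (simp add: D_def taylor_form_def sum_divide_distrib)
  moreover have "D n t / fact n = taylor_form n f (x + t *\<^sub>R z) z"
    by (simp add: D_def taylor_form_def sum_divide_distrib)
  moreover have "\<bar>taylor_form n f (x + t *\<^sub>R z) z\<bar> \<le> real CARD('n) ^ n * M * norm z ^ n"
    using t line[of t] by (intro abs_taylor_form_le Ck_bounded_onD(3)[OF f]) auto
  ultimately show ?thesis
    using eq by simp
qed

lemma taylor_form_0: "taylor_form 0 f x z = f x"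
  by (simp add: taylor_form_def words_0)

lemma taylor_form_1: "taylor_form 1 f x z = (\<Sum>i\<in>UNIV. z $ i * partial_deriv i f x)"
  unfolding taylor_form_def sum_words_1 by simp

section \<open>Integrability and symmetries\<close>

text \<open>Dyadic decomposition: on the shell 2^-(k+1) \<le> |z| < 2^-k the integrand is at most c
  2^(s k), and the ball of radius 2^-k has volume V 2^-(d k). Replacing shells by balls only
  enlarges the sum, which is geometric with ratio q = 2^(s-d) < 1.\<close>

lemma set_integrable_norm_powr_ball:
  assumes "s < real DIM('a::euclidean_space)"
  shows "set_integrable lborel (ball (0::'a) 1) (\<lambda>z. 1 / norm z powr s)"
proof -
  define d where "d = DIM('a)"
  define q where "q = 2 powr (s - real d)"
  \<comment> \<open>Bounds t^-s for 1/2 \<le> t < 1; the absolute value covers negative s as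
    well.\<close>
  define c where "c = 2 powr \<bar>s\<bar>"
  have q: "0 < q" "q < 1"
    using assms powr_less_mono[of "s - real d" 0 2] by (auto simp: q_def d_def)
  define V where "V = unit_ball_vol (real d)"
  have shell: "\<exists>k. norm z < (1/2) ^ k \<and> 1 / norm z powr s \<le> c * 2 powr (s * k)"
    if z: "z \<noteq> 0" "norm z < 1" for z :: 'a
  proof -
    obtain n where "(1/2) ^ n < norm z"
      using real_arch_pow_inv[of "norm z" "1/2"] z by auto
    then have ex: "\<exists>n. (1/2) ^ n \<le> norm z"
      by (intro exI[of _ n]) simp
    \<comment> \<open>Minimality of \<open>m\<close> puts z into the shell with index
      \<open>k = m - 1\<close>; \<open>m\<close> is not 0 because |z| < 1.\<close>
    define m where "m = (LEAST n. (1/2) ^ n \<le> norm z)"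
    have m: "(1/2) ^ m \<le> norm z"
      unfolding m_def using ex by (rule LeastI_ex)
    have "m \<noteq> 0"
      using m z by (intro notI) simp
    then obtain k where k: "m = Suc k"
      by (cases m) auto
    have lt: "norm z < (1/2) ^ k"
      using not_less_Least[of k "\<lambda>n. (1/2) ^ n \<le> norm z"] k by (simp add: m_def)
    define t where "t = norm z * 2 powr real k"
    have "t < 1"
      using lt by (simp add: t_def powr_realpow power_one_over field_simps)
    have "1 / 2 \<le> t"
      using m by (simp add: k t_def powr_realpow power_one_over field_simps)
    have "norm z = t * 2 powr (- real k)"
      by (simp add: t_def powr_minus field_simps)
    then have "norm z powr s = t powr s * 2 powr (- (s * real k))"
      using \<open>1 / 2 \<le> t\<close> by (simp add: powr_mult powr_powr mult.commute)
    then have "1 / norm z powr s = t powr (- s) * 2 powr (s * k)"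
      using z \<open>1 / 2 \<le> t\<close> by (auto simp: powr_minus field_simps)
    also have "t powr (- s) \<le> c"
    proof (cases "0 \<le> s")
      case True
      have "t powr (- s) \<le> (1 / 2) powr (- s)"
        using True \<open>1 / 2 \<le> t\<close> by (intro powr_mono2') auto
      then show ?thesis
        using True by (simp add: c_def powr_minus powr_divide)
    next
      case False
      then have "t powr (- s) \<le> 1 powr (- s)"
        using \<open>1 / 2 \<le> t\<close> \<open>t < 1\<close> by (intro powr_mono2) auto
      then show ?thesis
        using False ge_one_powr_ge_zero[of 2 "\<bar>s\<bar>"] by (simp add: c_def)
    qed
    finally have "1 / norm z powr s \<le> c * 2 powr (s * k)"
      by simp
    with lt show ?thesis
      by blast
  qed
  have "(\<integral>\<^sup>+ z. ennreal (norm (indicator (ball (0::'a) 1) z *\<^sub>R (1 / norm z powr s))) \<partial>lborel) \<le>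
      (\<integral>\<^sup>+ z. (\<Sum>k. ennreal (c * 2 powr (s * real k)) * indicator (ball (0::'a) ((1/2) ^ k)) z) \<partial>lborel)"
  proof (rule nn_integral_mono)
    fix z :: 'a
    show "ennreal (norm (indicator (ball (0::'a) 1) z *\<^sub>R (1 / norm z powr s))) \<le>
        (\<Sum>k. ennreal (c * 2 powr (s * real k)) * indicator (ball (0::'a) ((1/2) ^ k)) z)"
    proof (cases "z \<noteq> 0 \<and> norm z < 1")
      case True
      then obtain k where k: "norm z < (1/2) ^ k" "1 / norm z powr s \<le> c * 2 powr (s * k)"
        using shell by blast
      define g where "g k = ennreal (c * 2 powr (s * real k)) * indicator (ball (0::'a) ((1/2) ^ k)) z"
        for k
      have "ennreal (norm (indicator (ball (0::'a) 1) z *\<^sub>R (1 / norm z powr s))) \<le> g k"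
        using True k by (auto simp: g_def intro!: ennreal_leI)
      also have "\<dots> = (\<Sum>n\<in>{k}. g n)"
        by simp
      also have "\<dots> \<le> suminf g"
        by (rule sum_le_suminf) auto
      finally show ?thesis
        by (simp add: g_def[abs_def])
    qed (auto simp: indicator_def)
  qed
  also have "\<dots> = (\<Sum>k. ennreal (c * 2 powr (s * real k)) * emeasure lborel (ball (0::'a) ((1/2) ^ k)))"
  proof (subst nn_integral_suminf)
    show "(\<lambda>z. ennreal (c * 2 powr (s * real k)) * indicator (ball (0::'a) ((1/2) ^ k)) z)
        \<in> borel_measurable lborel" for k
      by (intro borel_measurable_times_ennreal borel_measurable_const borel_measurable_indicator) simp
    show "(\<Sum>k. \<integral>\<^sup>+ z. ennreal (c * 2 powr (s * real k)) * indicator (ball (0::'a) ((1/2) ^ k)) z \<partial>lborel) =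
        (\<Sum>k. ennreal (c * 2 powr (s * real k)) * emeasure lborel (ball (0::'a) ((1/2) ^ k)))"
      by (intro suminf_cong nn_integral_cmult_indicator) simp
  qed
  also have "\<dots> = (\<Sum>k. ennreal (c * V * q ^ k))"
  proof (rule suminf_cong)
    fix k
    have "((1/2::real) ^ k) ^ d = 2 powr (- (real k * real d))"
      using powr_realpow[of 2 "k * d"] by (simp add: power_one_over power_mult powr_minus inverse_eq_divide)
    moreover have "q ^ k = 2 powr (s * real k + - (real k * real d))"
      unfolding q_def by (subst powr_power) (auto simp: algebra_simps)
    ultimately have "2 powr (s * real k) * ((1/2) ^ k) ^ d = q ^ k"
      by (simp only: powr_add)
    then have eq: "c * 2 powr (s * real k) * (V * ((1/2) ^ k) ^ d) = c * V * q ^ k"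
      by (simp add: mult_ac)
    have "emeasure lborel (ball (0::'a) ((1/2) ^ k)) = ennreal (V * ((1/2) ^ k) ^ d)"
      by (simp add: emeasure_ball V_def d_def)
    then have "ennreal (c * 2 powr (s * real k)) * emeasure lborel (ball (0::'a) ((1/2) ^ k)) =
        ennreal (c * 2 powr (s * real k)) * ennreal (V * ((1/2) ^ k) ^ d)"
      by simp
    also have "\<dots> = ennreal (c * 2 powr (s * real k) * (V * ((1/2) ^ k) ^ d))"
      by (rule ennreal_mult[symmetric]) (auto simp: c_def V_def)
    finally show "ennreal (c * 2 powr (s * real k)) * emeasure lborel (ball (0::'a) ((1/2) ^ k)) =
        ennreal (c * V * q ^ k)"
      by (simp only: eq)
  qed
  also have "\<dots> = ennreal (\<Sum>k. c * V * q ^ k)"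
    using q by (intro suminf_ennreal2 summable_mult summable_geometric)
       (auto simp: c_def V_def d_def)
  also have "\<dots> < \<infinity>"
    by simp
  finally show ?thesis
    unfolding set_integrable_def
    by (intro integrableI_bounded borel_measurable_scaleR borel_measurable_indicator) auto
qed

text \<open>The preimage of a box is a box with the same side lengths in another order, and Lebesgue
  measure is determined by its values on boxes.\<close>

lemma lborel_distr_permute:
  assumes p: "p permutes (UNIV :: 'n::finite set)"
  shows "distr lborel borel (\<lambda>z :: real^'n. \<chi> k. z $ p k) = lborel"
proof (rule lborel_eqI[symmetric])
  have [measurable]: "(\<lambda>z :: real^'n. \<chi> k. z $ p k) \<in> borel_measurable borel"
    by (intro borel_measurable_continuous_onI continuous_intros)
  fix l u :: "real^'n"
  assume lu: "\<And>b. b \<in> Basis \<Longrightarrow> l \<bullet> b \<le> u \<bullet> b"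
  then have lu': "l $ k \<le> u $ k" for k
    using lu[of "axis k 1"] by (simp add: axis_in_Basis_iff inner_axis)
  define l' u' :: "real^'n" where "l' = (\<chi> k. l $ inv p k)" and "u' = (\<chi> k. u $ inv p k)"
  have *: "(\<forall>k. l $ k < z $ p k \<and> z $ p k < u $ k) \<longleftrightarrow> (\<forall>k. l $ inv p k < z $ k \<and> z $ k < u $ inv p k)"
    for z :: "real^'n"
    by (metis p permutes_inverses(1) permutes_inverses(2))
  have "(\<lambda>z. \<chi> k. z $ p k) -` box l u = box l' u'"
    using * by (auto simp: mem_box_cart l'_def u'_def)
  then have "emeasure (distr lborel borel (\<lambda>z :: real^'n. \<chi> k. z $ p k)) (box l u) =
      emeasure lborel (box l' u')"
    by (subst emeasure_distr) auto
  also have "\<dots> = ennreal (\<Prod>b\<in>Basis. (u' - l') \<bullet> b)"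
    using lu' by (intro emeasure_lborel_box) (auto simp: Basis_vec_def inner_axis l'_def u'_def)
  also have "(\<Prod>b\<in>Basis. (u' - l') \<bullet> b) = (\<Prod>k\<in>UNIV. (u' - l') $ k)"
    by (simp add: Basis_vec_def prod.UNION_disjoint inner_axis prod.reindex inj_on_def axis_eq_axis)
  also have "\<dots> = (\<Prod>k\<in>UNIV. (u - l) $ inv p k)"
    by (simp add: l'_def u'_def)
  also have "\<dots> = (\<Prod>k\<in>UNIV. (u - l) $ k)"
    using p by (intro prod.reindex_bij_betw permutes_imp_bij permutes_inv)
  also have "\<dots> = (\<Prod>b\<in>Basis. (u - l) \<bullet> b)"
    by (simp add: Basis_vec_def prod.UNION_disjoint inner_axis prod.reindex inj_on_def axis_eq_axis)
  finally show "emeasure (distr lborel borel (\<lambda>z :: real^'n. \<chi> k. z $ p k)) (box l u) =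
      ennreal (\<Prod>b\<in>Basis. (u - l) \<bullet> b)" .
qed auto

lemma lborel_distr_signs:
  fixes c :: "'n::finite \<Rightarrow> real"
  assumes c: "\<And>k. \<bar>c k\<bar> = 1"
  shows "distr lborel borel (\<lambda>z :: real^'n. \<chi> k. c k * z $ k) = lborel"
proof -
  \<comment> \<open>\<open>lborel_affine_euclidean\<close> expects factors indexed by basis vectors;
    \<open>c'\<close> transports the signs from coordinates to the vectors \<open>axis k 1\<close>.
    Their moduli multiply to 1, so no density appears.\<close>
  define c' :: "real^'n \<Rightarrow> real" where "c' j = (\<Sum>k\<in>UNIV. c k * j $ k)" for j
  have c': "c' (axis k 1) = c k" for k
    by (simp add: c'_def axis_def if_distrib cong: if_cong)
  have "0 + (\<Sum>j\<in>Basis. (c' j * (z \<bullet> j)) *\<^sub>R j) = (\<chi> k. c k * z $ k)" for z :: "real^'n"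
  proof -
    have "(\<Sum>j\<in>Basis. (c' j * (z \<bullet> j)) *\<^sub>R j) = (\<Sum>k\<in>UNIV. (c k * z $ k) *\<^sub>R axis k (1::real))"
      by (simp add: Basis_vec_def sum.UNION_disjoint inner_axis sum.reindex inj_on_def axis_eq_axis c')
    also have "\<dots> = (\<chi> k. c k * z $ k)"
      using basis_expansion[of "\<chi> k. c k * z $ k"] by (simp add: scalar_mult_eq_scaleR)
    finally show ?thesis
      by simp
  qed
  moreover have "(\<Prod>j\<in>Basis. \<bar>c' j\<bar>) = 1"
    by (intro prod.neutral) (auto simp: Basis_vec_def c' c)
  moreover have "\<And>j. j \<in> Basis \<Longrightarrow> c' j \<noteq> 0"
    using c by (auto simp: Basis_vec_def c') (metis abs_zero zero_neq_one)
  ultimately show ?thesis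
    using lborel_affine_euclidean[of c' 0] by (simp add: density_1)
qed

section \<open>Measures with isotropic moments\<close>

lemma
  fixes F :: "'a::euclidean_space \<Rightarrow> real"
  assumes [measurable]: "F \<in> borel_measurable borel" and c: "0 < c"
    and int: "integrable lborel (\<lambda>z. F (t + c *\<^sub>R z))"
  shows lborel_integrable_affine: "integrable lborel F"
    and lborel_integral_affine:
      "integral\<^sup>L lborel F = c ^ DIM('a) * integral\<^sup>L lborel (\<lambda>z. F (t + c *\<^sub>R z))"
proof -
  have eq: "lborel = density (distr lborel borel (\<lambda>x::'a. t + c *\<^sub>R x)) (\<lambda>_. ennreal (\<bar>c\<bar> ^ DIM('a)))"
    using lborel_affine[of c t] c by simp
  show "integrable lborel F"
    using int c by (subst eq) (simp add: integrable_density integrable_distr_eq)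
  show "integral\<^sup>L lborel F = c ^ DIM('a) * integral\<^sup>L lborel (\<lambda>z. F (t + c *\<^sub>R z))"
    using c by (subst eq) (simp add: integral_density integral_distr)
qed

text \<open>A measure with these moments integrates every cubic polynomial in \<open>y - x\<close> without constant
  term to half its Laplacian at \<open>x\<close>. Both the rescaled kernel and the meshfree
  quadrature rule are of this kind.\<close>

locale isotropic_measure = finite_measure \<mu>
  for \<mu> :: "(real^'n::finite) measure" and x :: "real^'n" and \<delta> :: real +
  assumes \<delta>_pos: "0 < \<delta>"
    and space_subset: "space \<mu> \<subseteq> ball x \<delta>"
    and measurable_continuous:
      "\<And>g :: real^'n \<Rightarrow> real. continuous_on (ball x \<delta>) g \<Longrightarrow> g \<in> borel_measurable \<mu>"
    and odd_moments:
      "\<And>js. length js = 1 \<or> length js = 3 \<Longrightarrow> (\<integral>y. monomial js (y - x) \<partial>\<mu>) = 0"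
    and second_moments: "\<And>i j. (\<integral>y. monomial [i, j] (y - x) \<partial>\<mu>) = of_bool (i = j)"
begin

lemma integrable_continuous_bounded:
  fixes g :: "real^'n \<Rightarrow> real"
  assumes "continuous_on (ball x \<delta>) g" "\<And>y. y \<in> ball x \<delta> \<Longrightarrow> \<bar>g y\<bar> \<le> K"
  shows "integrable \<mu> g"
  using assms space_subset measurable_continuous
  by (intro integrable_const_bound[where B = K] AE_I2) auto

lemma norm_less: "y \<in> space \<mu> \<Longrightarrow> norm (y - x) < \<delta>"
  using space_subset by (auto simp: dist_norm norm_minus_commute)

lemma integrable_monomial [simp]: "integrable \<mu> (\<lambda>y. monomial js (y - x))"
proof (rule integrable_continuous_bounded)
  show "continuous_on (ball x \<delta>) (\<lambda>y. monomial js (y - x))"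
    by (intro continuous_intros)
  show "\<bar>monomial js (y - x)\<bar> \<le> \<delta> ^ length js" if "y \<in> ball x \<delta>" for y
    using that by (intro order_trans[OF abs_monomial_le] power_mono)
       (auto simp: dist_norm norm_minus_commute)
qed

lemma integrable_norm_power [simp]: "integrable \<mu> (\<lambda>y. norm (y - x) ^ k)"
proof (rule integrable_continuous_bounded)
  show "\<bar>norm (y - x) ^ k\<bar> \<le> \<delta> ^ k" if "y \<in> ball x \<delta>" for y
    using that by (auto intro!: power_mono simp: dist_norm norm_minus_commute)
qed (intro continuous_intros)

lemma integral_norm_square: "(\<integral>y. (norm (y - x))\<^sup>2 \<partial>\<mu>) = real CARD('n)"
proof -
  have "(norm z)\<^sup>2 = (\<Sum>i\<in>UNIV. monomial [i, i] z)" for z :: "real^'n"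
    by (simp add: norm_vec_def L2_set_def sum_nonneg power2_eq_square)
  then show ?thesis
    using second_moments by (simp del: monomial_Cons)
qed

end

section \<open>The rescaled kernel as an isotropic measure\<close>

definition kernel_measure :: "real \<Rightarrow> real \<Rightarrow> real^'n::finite \<Rightarrow> real \<Rightarrow> (real^'n) measure" where
  "kernel_measure D\<^sub>0 s x \<delta> = density (restrict_space lborel (ball x \<delta>))
     (\<lambda>y. scaled_kernel CARD('n) (\<lambda>t. D\<^sub>0 / t powr s) \<delta> (norm (x - y)))"

lemma measurable_kernel_measure:
  fixes g :: "real^'n::finite \<Rightarrow> real"
  assumes "continuous_on (ball x \<delta>) g"
  shows "g \<in> borel_measurable (restrict_space lborel (ball x \<delta>))"
    and "g \<in> borel_measurable (kernel_measure D\<^sub>0 s x \<delta>)"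
proof -
  have "g \<in> borel_measurable (restrict_space borel (ball x \<delta>))"
    using assms by (rule borel_measurable_continuous_on_restrict)
  also have "borel_measurable (restrict_space borel (ball x \<delta>)) =
      borel_measurable (restrict_space lborel (ball x \<delta>))"
    by (intro measurable_cong_sets sets_restrict_space_cong) auto
  finally show "g \<in> borel_measurable (restrict_space lborel (ball x \<delta>))" .
  then show "g \<in> borel_measurable (kernel_measure D\<^sub>0 s x \<delta>)"
    by (simp add: kernel_measure_def)
qed

text \<open>The type token \<open>dim\<close> fixes \<open>'n\<close>, which occurs in the
  assumptions but in the type of no other parameter.\<close>

locale power_kernel =
  fixes \<gamma>\<^sub>1 :: "real \<Rightarrow> real" and D\<^sub>0 s :: real and dim :: "'n::finite itself"
  assumes D\<^sub>0_pos: "0 < D\<^sub>0" and s_less: "s < real CARD('n)"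
    and kernel_eq: "\<And>t. 0 < t \<Longrightarrow> t < 1 \<Longrightarrow> \<gamma>\<^sub>1 t = D\<^sub>0 / t powr s"
    and kernel_normalized:
      "(LINT z:ball (0::real^'n) 1|lborel. \<gamma>\<^sub>1 (norm z) * (norm z)\<^sup>2) = real CARD('n)"
begin

abbreviation kernel :: "real \<Rightarrow> real^'n \<Rightarrow> real^'n \<Rightarrow> real" where
  "kernel \<delta> x y \<equiv> scaled_kernel CARD('n) (\<lambda>t. D\<^sub>0 / t powr s) \<delta> (norm (x - y))"

lemma kernel_nonneg: "0 < \<delta> \<Longrightarrow> 0 \<le> kernel \<delta> x y"
  using D\<^sub>0_pos by (simp add: scaled_kernel_def)

lemma measurable_kernel [measurable]: "kernel \<delta> x \<in> borel_measurable borel"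
  unfolding scaled_kernel_def by measurable

lemma kernel_eq_scaled_kernel:
  "0 < \<delta> \<Longrightarrow> y \<in> ball x \<delta> \<Longrightarrow> y \<noteq> x \<Longrightarrow> kernel \<delta> x y = scaled_kernel CARD('n) \<gamma>\<^sub>1 \<delta> (norm (x - y))"
  using kernel_eq[of "norm (x - y) / \<delta>"] by (simp add: scaled_kernel_def dist_norm)

lemma
  fixes g :: "real^'n \<Rightarrow> real"
  assumes g: "g \<in> borel_measurable (restrict_space lborel (ball x \<delta>))" and \<delta>: "0 < \<delta>"
  shows integral_kernel_measure_lborel: "integral\<^sup>L (kernel_measure D\<^sub>0 s x \<delta>) g =
      integral\<^sup>L lborel (\<lambda>y. indicator (ball x \<delta>) y * (kernel \<delta> x y * g y))"
    and integrable_kernel_measure_iff: "integrable (kernel_measure D\<^sub>0 s x \<delta>) g \<longleftrightarrow>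
      integrable lborel (\<lambda>y. indicator (ball x \<delta>) y * (kernel \<delta> x y * g y))"
proof -
  have [measurable]: "kernel \<delta> x \<in> borel_measurable (restrict_space lborel (ball x \<delta>))"
    by (intro measurable_restrict_space1) measurable
  show "integral\<^sup>L (kernel_measure D\<^sub>0 s x \<delta>) g =
      integral\<^sup>L lborel (\<lambda>y. indicator (ball x \<delta>) y * (kernel \<delta> x y * g y))"
    unfolding kernel_measure_def using g kernel_nonneg[OF \<delta>]
    by (subst integral_density) (auto simp: integral_restrict_space)
  show "integrable (kernel_measure D\<^sub>0 s x \<delta>) g \<longleftrightarrow>
      integrable lborel (\<lambda>y. indicator (ball x \<delta>) y * (kernel \<delta> x y * g y))"
    unfolding kernel_measure_def using g kernel_nonneg[OF \<delta>]
    by (subst integrable_density) (auto simp: integrable_restrict_space)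
qed

text \<open>On the ball, the power law in \<open>kernel_measure\<close> and
  \<open>\<gamma>\<^sub>1\<close> can differ only at the centre, where
  \<open>\<gamma>\<^sub>1 0\<close> is unconstrained; a single point is a null set.\<close>

lemma integral_kernel_measure:
  fixes g :: "real^'n \<Rightarrow> real"
  assumes g: "g \<in> borel_measurable (restrict_space lborel (ball x \<delta>))" and \<delta>: "0 < \<delta>"
  shows "integral\<^sup>L (kernel_measure D\<^sub>0 s x \<delta>) g =
     (LINT y:ball x \<delta>|lborel. g y * scaled_kernel CARD('n) \<gamma>\<^sub>1 \<delta> (norm (x - y)))"
  unfolding integral_kernel_measure_lborel[OF assms] set_lebesgue_integral_def
  by (rule integral_discrete_difference[where X = "{x}"])
     (auto simp: indicator_def kernel_eq_scaled_kernel[OF \<delta>])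

definition unit_moment :: "'n list \<Rightarrow> real" where
  "unit_moment js =
     (\<integral>z. indicator (ball 0 1) z * (monomial js z * (D\<^sub>0 / norm z powr s)) \<partial>lborel)"

lemma ball_in_sets_borel [measurable]: "ball a e \<in> sets borel"
  by simp

lemma measurable_monomial [measurable]: "monomial js \<in> borel_measurable borel"
  using continuous_on_monomial[OF continuous_on_id] by (intro borel_measurable_continuous_onI) auto

text \<open>On the unit ball every monomial is at most 1 in modulus, so all moments are dominated by
  the total mass, which is finite because s < d.\<close>

lemma integrable_unit_moment:
  "integrable lborel (\<lambda>z :: real^'n. indicator (ball 0 1) z * (monomial js z * (D\<^sub>0 / norm z powr s)))"
proof (rule Bochner_Integration.integrable_bound)
  show "integrable lborel (\<lambda>z :: real^'n. D\<^sub>0 * (indicator (ball 0 1) z * (1 / norm z powr s)))"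
    using set_integrable_norm_powr_ball[where 'a = "real^'n" and s = s] s_less
    by (intro integrable_mult_right) (simp add: set_integrable_def)
  have "\<bar>monomial js z\<bar> \<le> 1" if "norm z < 1" for z :: "real^'n"
    using that abs_monomial_le[of js z] power_le_one[of "norm z" "length js"] by simp
  then show "AE z in lborel. norm (indicator (ball 0 1) z * (monomial js z * (D\<^sub>0 / norm z powr s)))
      \<le> norm (D\<^sub>0 * (indicator (ball 0 1) z * (1 / norm (z :: real^'n) powr s)))"
    using D\<^sub>0_pos by (intro AE_I2) (auto simp: indicator_def abs_mult intro!: divide_right_mono mult_left_le_one_le)
qed measurable

text \<open>A norm-preserving substitution that keeps Lebesgue measure leaves the ball and the
  radial kernel unchanged, so only the monomial is affected. The symmetries of the moments below are
  instances.\<close>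

lemma unit_moment_invariant:
  assumes T: "distr lborel borel T = lborel" "T \<in> borel_measurable borel" "\<And>z. norm (T z) = norm z"
    and "\<And>z. monomial js (T z) = c * monomial ks z"
  shows "unit_moment js = c * unit_moment ks"
proof -
  have "unit_moment js = (\<integral>z. indicator (ball 0 1) z * (monomial js z * (D\<^sub>0 / norm z powr s))
      \<partial>(distr lborel borel T))"
    by (simp add: unit_moment_def T(1))
  also have "\<dots> = (\<integral>z. indicator (ball 0 1) (T z) * (monomial js (T z) * (D\<^sub>0 / norm (T z) powr s))
      \<partial>lborel)"
    using T(2) by (intro integral_distr) auto
  also have "\<dots> = (\<integral>z. c * (indicator (ball 0 1) z * (monomial ks z * (D\<^sub>0 / norm z powr s))) \<partial>lborel)"
    using assms by (intro Bochner_Integration.integral_cong) (auto simp: indicator_def)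
  also have "\<dots> = c * unit_moment ks"
    by (simp only: unit_moment_def integral_mult_right_zero)
  finally show ?thesis .
qed

lemma norm_eq_if_squares_eq:
  fixes z w :: "real^'m::finite"
  shows "(\<Sum>i\<in>UNIV. (z $ i)\<^sup>2) = (\<Sum>i\<in>UNIV. (w $ i)\<^sup>2) \<Longrightarrow> norm z = norm w"
  by (simp add: norm_vec_def L2_set_def)

lemma unit_moment_signs:
  fixes c :: "'n \<Rightarrow> real"
  assumes "\<And>k. \<bar>c k\<bar> = 1"
  shows "unit_moment js = (\<Prod>j\<leftarrow>js. c j) * unit_moment js"
proof (rule unit_moment_invariant)
  show "distr lborel borel (\<lambda>z :: real^'n. \<chi> k. c k * z $ k) = lborel"
    using assms by (rule lborel_distr_signs)
  have "(c k)\<^sup>2 = 1" for k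
    using assms[of k] by (metis one_power2 power2_abs)
  then show "norm (\<chi> k. c k * z $ k) = norm z" for z :: "real^'n"
    by (intro norm_eq_if_squares_eq) (simp add: power_mult_distrib)
  show "monomial js (\<chi> k. c k * z $ k) = (\<Prod>j\<leftarrow>js. c j) * monomial js z" for z :: "real^'n"
    by (induction js) auto
qed (intro borel_measurable_continuous_onI continuous_intros)

text \<open>Under z -> -z an odd moment becomes its own negative.\<close>

lemma unit_moment_odd:
  assumes "odd (length js)"
  shows "unit_moment js = 0"
proof -
  have "(\<Prod>j\<leftarrow>js. - 1 :: real) = (- 1) ^ length js"
    by (induction js) auto
  then show ?thesis
    using unit_moment_signs[of "\<lambda>_. - 1" js] assms by simp
qed

text \<open>Flipping the sign of coordinate i alone negates the moment.\<close>

lemma unit_moment_distinct: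
  assumes "i \<noteq> j"
  shows "unit_moment [i, j] = 0"
  using unit_moment_signs[of "\<lambda>k. if k = i then - 1 else 1" "[i, j]"] assms by simp

lemma unit_moment_swap: "unit_moment [i, i] = unit_moment [j, j]"
proof -
  have p: "Transposition.transpose i j permutes (UNIV :: 'n set)"
    by (simp add: permutes_def transpose_eq_iff) (metis transpose_involutory)
  have "unit_moment [i, i] = 1 * unit_moment [j, j]"
  proof (rule unit_moment_invariant)
    show "distr lborel borel (\<lambda>z :: real^'n. \<chi> k. z $ Transposition.transpose i j k) = lborel"
      using p by (rule lborel_distr_permute)
    show "norm (\<chi> k. z $ Transposition.transpose i j k) = norm z" for z :: "real^'n"
      using sum.reindex_bij_betw[OF permutes_imp_bij[OF p], of "\<lambda>k. (z $ k)\<^sup>2"]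
      by (intro norm_eq_if_squares_eq) simp
  qed (auto intro!: borel_measurable_continuous_onI continuous_intros)
  then show ?thesis
    by simp
qed

text \<open>The d pure second moments coincide by \<open>unit_moment_swap\<close>, and their sum is
  the integral normalized to d.\<close>

lemma unit_moment_square: "unit_moment [i, i] = 1"
proof -
  have "real CARD('n) = (\<integral>z. indicator (ball 0 1) z * ((norm z)\<^sup>2 * (D\<^sub>0 / norm (z::real^'n) powr s)) \<partial>lborel)"
    unfolding kernel_normalized[symmetric] set_lebesgue_integral_def
  proof (intro Bochner_Integration.integral_cong refl)
    fix z :: "real^'n"
    \<comment> \<open>\<open>kernel_eq\<close> says nothing at the origin, but there the factor
      |z|^2 makes both sides vanish.\<close>
    show "indicat_real (ball 0 1) z *\<^sub>R (\<gamma>\<^sub>1 (norm z) * (norm z)\<^sup>2) =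
        indicator (ball 0 1) z * ((norm z)\<^sup>2 * (D\<^sub>0 / norm z powr s))"
      using kernel_eq[of "norm z"] by (cases "z = 0") (auto simp: indicator_def)
  qed
  also have "\<dots> = (\<integral>z. (\<Sum>k\<in>UNIV. indicator (ball 0 1) z * (monomial [k, k] z * (D\<^sub>0 / norm (z::real^'n) powr s))) \<partial>lborel)"
  proof (intro Bochner_Integration.integral_cong refl)
    fix z :: "real^'n"
    have "(norm z)\<^sup>2 = (\<Sum>k\<in>UNIV. monomial [k, k] z)"
      by (simp add: norm_vec_def L2_set_def sum_nonneg power2_eq_square)
    then show "indicator (ball 0 1) z * ((norm z)\<^sup>2 * (D\<^sub>0 / norm z powr s)) =
        (\<Sum>k\<in>UNIV. indicator (ball 0 1) z * (monomial [k, k] z * (D\<^sub>0 / norm z powr s)))"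
      by (simp only: sum_distrib_left sum_distrib_right)
  qed
  also have "\<dots> = (\<Sum>k\<in>UNIV. unit_moment [k, k])"
    unfolding unit_moment_def
    by (rule Bochner_Integration.integral_sum) (rule integrable_unit_moment)
  also have "\<dots> = (\<Sum>k\<in>(UNIV :: 'n set). unit_moment [i, i])"
    by (intro sum.cong refl unit_moment_swap)
  finally show ?thesis
    by simp
qed

text \<open>Substituting y = x + \<delta> z gives \<delta>^d from the volume, \<delta>^-(d+2) from
  the kernel and \<delta>^k from a monomial of degree k. The net power k - 2 makes the second
  moments independent of \<delta>.\<close>

lemma
  assumes \<delta>: "0 < \<delta>"
  shows integrable_kernel_monomial:
      "integrable (kernel_measure D\<^sub>0 s x \<delta>) (\<lambda>y. monomial js (y - x :: real^'n))"
    and integral_kernel_monomial: "(\<integral>y. monomial js (y - x :: real^'n) \<partial>kernel_measure D\<^sub>0 s x \<delta>) =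
      \<delta> ^ length js / \<delta>\<^sup>2 * unit_moment js"
proof -
  define F where "F y = indicator (ball x \<delta>) y * (kernel \<delta> x y * monomial js (y - x))" for y
  have [measurable]: "F \<in> borel_measurable borel"
    unfolding F_def by measurable
  have m: "monomial js (\<delta> *\<^sub>R z) = \<delta> ^ length js * monomial js z" for z
    by (induction js) auto
  define c where "c = \<delta> ^ length js / \<delta> ^ (CARD('n) + 2)"
  have F: "F (x + \<delta> *\<^sub>R z) =
      c * (indicator (ball 0 1) z * (monomial js z * (D\<^sub>0 / norm z powr s)))" for z
    using \<delta> by (simp add: F_def c_def scaled_kernel_def m indicator_def dist_norm)
  have g: "(\<lambda>y. monomial js (y - x)) \<in> borel_measurable (restrict_space lborel (ball x \<delta>))"
    by (intro measurable_kernel_measure(1) continuous_intros)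
  have int: "integrable lborel (\<lambda>z. F (x + \<delta> *\<^sub>R z))"
    unfolding F by (intro integrable_mult_right integrable_unit_moment)
  show "integrable (kernel_measure D\<^sub>0 s x \<delta>) (\<lambda>y. monomial js (y - x))"
    unfolding integrable_kernel_measure_iff[OF g \<delta>]
    using lborel_integrable_affine[OF _ \<delta> int] by (simp add: F_def[abs_def])
  have "(\<integral>y. monomial js (y - x) \<partial>kernel_measure D\<^sub>0 s x \<delta>) = integral\<^sup>L lborel F"
    unfolding integral_kernel_measure_lborel[OF g \<delta>] F_def ..
  also have "\<dots> = \<delta> ^ CARD('n) * (c * unit_moment js)"
    using lborel_integral_affine[OF _ \<delta> int]
    by (simp only: \<open>F \<in> borel_measurable borel\<close> F unit_moment_def integral_mult_right_zero
        DIM_cart DIM_real mult_1_right)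
  also have "\<dots> = \<delta> ^ length js / \<delta>\<^sup>2 * unit_moment js"
    using \<delta> by (simp add: c_def power_add power2_eq_square)
  finally show "(\<integral>y. monomial js (y - x) \<partial>kernel_measure D\<^sub>0 s x \<delta>) =
      \<delta> ^ length js / \<delta>\<^sup>2 * unit_moment js" .
qed

lemma isotropic_kernel_measure:
  assumes \<delta>: "0 < \<delta>"
  shows "isotropic_measure (kernel_measure D\<^sub>0 s x \<delta>) (x :: real^'n) \<delta>"
proof -
  \<comment> \<open>The empty word gives the zeroth moment, so its integrability is finiteness of
    the measure.\<close>
  have "integrable (kernel_measure D\<^sub>0 s x \<delta>) (\<lambda>_. 1 :: real)"
    using integrable_kernel_monomial[OF \<delta>, of x "[]"] by simp
  then interpret finite_measure "kernel_measure D\<^sub>0 s x \<delta>"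
    by (intro finite_measureI) (simp add: integrable_iff_bounded)
  show ?thesis
  proof unfold_locales
    show "space (kernel_measure D\<^sub>0 s x \<delta>) \<subseteq> ball x \<delta>"
      by (simp add: kernel_measure_def space_restrict_space)
    show "(\<integral>y. monomial js (y - x) \<partial>kernel_measure D\<^sub>0 s x \<delta>) = 0"
      if "length js = 1 \<or> length js = 3" for js
      using that integral_kernel_monomial[OF \<delta>, of x js] unit_moment_odd[of js] by auto
    show "(\<integral>y. monomial [i, j] (y - x) \<partial>kernel_measure D\<^sub>0 s x \<delta>) = of_bool (i = j)" for i j
      using integral_kernel_monomial[OF \<delta>, of x "[i, j]"] unit_moment_square unit_moment_distinct \<delta>
      by (auto simp: power2_eq_square)
  qed (use \<delta> measurable_kernel_measure(2) in auto)
qed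

end

section \<open>The meshfree quadrature rule as an isotropic measure\<close>

lemma polynomial_deg_le_monomial:
  assumes "length js \<le> k"
  shows "polynomial_deg_le k (monomial js :: real^'n::finite \<Rightarrow> real)"
proof -
  \<comment> \<open>A word corresponds to the multi-index that counts the occurrences of each
    coordinate.\<close>
  have count: "(\<Sum>i\<in>UNIV. count_list js i) = length js"
  proof (induction js)
    case (Cons j js)
    have "(\<Sum>i\<in>UNIV. count_list (j # js) i) = (\<Sum>i\<in>UNIV. of_bool (i = j) + count_list js i)"
      by (intro sum.cong) auto
    then show ?case
      using Cons by (simp add: sum.distrib)
  qed simp
  have "monomial js z = (\<Prod>i\<in>UNIV. (z $ i) ^ count_list js i)" for z :: "real^'n"
  proof (induction js)
    case (Cons j js)
    have "(\<Prod>i\<in>UNIV. (z $ i) ^ count_list (j # js) i) =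
        (\<Prod>i\<in>UNIV. (if i = j then z $ i else 1) * (z $ i) ^ count_list js i)"
      by (intro prod.cong) auto
    then show ?case
      using Cons by (simp add: prod.distrib)
  qed simp
  moreover have "(\<Sum>\<alpha> | (\<Sum>i\<in>UNIV. \<alpha> i) \<le> k. of_bool (\<alpha> = count_list js) * (\<Prod>i\<in>UNIV. (z $ i) ^ \<alpha> i)) =
      (\<Prod>i\<in>UNIV. (z $ i) ^ count_list js i)" for z :: "real^'n"
  proof -
    have "(\<Sum>\<alpha> | (\<Sum>i\<in>UNIV. \<alpha> i) \<le> k. of_bool (\<alpha> = count_list js) * (\<Prod>i\<in>UNIV. (z $ i) ^ \<alpha> i)) =
        (\<Sum>\<alpha>\<in>{count_list js}. of_bool (\<alpha> = count_list js) * (\<Prod>i\<in>UNIV. (z $ i) ^ \<alpha> i))"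
      using finite_multi_indices[of k, where 'n = 'n] assms count
      by (intro sum.mono_neutral_right) auto
    then show ?thesis
      by simp
  qed
  ultimately show ?thesis
    unfolding polynomial_deg_le_def by (intro exI[of _ "\<lambda>\<alpha>. of_bool (\<alpha> = count_list js)"]) (simp add: fun_eq_iff)
qed

text \<open>Point masses at the stencil nodes. Since \<open>ennreal\<close> sends negative numbers
  to 0, the measure represents the quadrature sum only when the weights are nonnegative.\<close>

definition quadrature_measure ::
    "(real \<Rightarrow> real) \<Rightarrow> (real^'n::finite) set \<Rightarrow> real \<Rightarrow> real^'n \<Rightarrow> (real^'n \<Rightarrow> real) \<Rightarrow> (real^'n) measure" where
  "quadrature_measure \<gamma> X \<delta> x w = point_measure (stencil X \<delta> x)
     (\<lambda>y. ennreal (scaled_kernel CARD('n) \<gamma> \<delta> (norm (x - y)) * w y))"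

context power_kernel
begin

lemma quadrature_density_nonneg:
  fixes x :: "real^'n"
  assumes "0 < \<delta>" "y \<in> stencil X \<delta> x" "0 \<le> w y"
  shows "0 \<le> scaled_kernel CARD('n) \<gamma>\<^sub>1 \<delta> (norm (x - y)) * w y"
  using assms kernel_eq_scaled_kernel[of \<delta> y x] kernel_nonneg[of \<delta> x y] by (simp add: stencil_def)

lemma integral_quadrature_measure:
  fixes g :: "real^'n \<Rightarrow> real"
  assumes "0 < \<delta>" "finite X" "\<And>y. y \<in> stencil X \<delta> x \<Longrightarrow> 0 \<le> w y"
  shows "integral\<^sup>L (quadrature_measure \<gamma>\<^sub>1 X \<delta> x w) g =
      (\<Sum>y\<in>stencil X \<delta> x. g y * scaled_kernel CARD('n) \<gamma>\<^sub>1 \<delta> (norm (x - y)) * w y)"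
proof -
  have "finite (stencil X \<delta> x)"
    using assms by (simp add: stencil_def)
  then show ?thesis
    unfolding quadrature_measure_def using quadrature_density_nonneg[OF assms(1) _ assms(3)]
    by (subst lebesgue_integral_point_measure_finite) (auto simp: mult_ac)
qed

lemma integrable_quadrature_measure:
  fixes g :: "real^'n \<Rightarrow> real"
  assumes "0 < \<delta>" "finite X" "\<And>y. y \<in> stencil X \<delta> x \<Longrightarrow> 0 \<le> w y"
  shows "integrable (quadrature_measure \<gamma>\<^sub>1 X \<delta> x w) g"
proof -
  have "finite (stencil X \<delta> x)"
    using assms by (simp add: stencil_def)
  then show ?thesis
    unfolding quadrature_measure_def using quadrature_density_nonneg[OF assms(1) _ assms(3)]
    by (intro integrable_point_measure_finite) auto
qed

text \<open>Exactness on cubics transfers the kernel's moments for words of length at most 3, just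
  enough for the locale; fourth moments of the rule are not prescribed and are estimated
  separately.\<close>

lemma isotropic_quadrature_measure:
  fixes x :: "real^'n"
  assumes \<delta>: "0 < \<delta>" and X: "finite X" and w: "\<And>y. y \<in> stencil X \<delta> x \<Longrightarrow> 0 \<le> w y"
    and exact: "exact_quadrature \<gamma>\<^sub>1 X \<delta> x w"
  shows "isotropic_measure (quadrature_measure \<gamma>\<^sub>1 X \<delta> x w) x \<delta>"
proof -
  let ?\<mu> = "quadrature_measure \<gamma>\<^sub>1 X \<delta> x w"
  have "integrable ?\<mu> (\<lambda>_. 1 :: real)"
    using \<delta> X w by (rule integrable_quadrature_measure)
  then interpret finite_measure ?\<mu>
    by (intro finite_measureI) (simp add: integrable_iff_bounded)
  interpret K: isotropic_measure "kernel_measure D\<^sub>0 s x \<delta>" x \<delta>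
    using \<delta> by (rule isotropic_kernel_measure)
  have *: "(\<integral>y. monomial js (y - x) \<partial>?\<mu>) = (\<integral>y. monomial js (y - x) \<partial>kernel_measure D\<^sub>0 s x \<delta>)"
    if "length js \<le> 3" for js
  proof -
    have "(\<lambda>y. monomial js (y - x)) \<in> borel_measurable (restrict_space lborel (ball x \<delta>))"
      by (intro measurable_kernel_measure(1) continuous_intros)
    then show ?thesis
      using exact polynomial_deg_le_monomial[OF that]
      by (simp add: integral_quadrature_measure[OF \<delta> X w] integral_kernel_measure[OF _ \<delta>]
          exact_quadrature_def)
  qed
  show ?thesis
  proof unfold_locales
    show "space ?\<mu> \<subseteq> ball x \<delta>"
      by (auto simp: quadrature_measure_def space_point_measure stencil_def)
    show "g \<in> borel_measurable ?\<mu>" for g :: "real^'n \<Rightarrow> real"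
      by (simp add: quadrature_measure_def)
    show "(\<integral>y. monomial js (y - x) \<partial>?\<mu>) = 0" if "length js = 1 \<or> length js = 3" for js
      using that *[of js] K.odd_moments[of js] by auto
    show "(\<integral>y. monomial [i, j] (y - x) \<partial>?\<mu>) = of_bool (i = j)" for i j
      using *[of "[i, j]"] K.second_moments[of i j] by simp
  qed (rule \<delta>)
qed

end

section \<open>Integrals of products of Taylor terms\<close>

context isotropic_measure
begin

lemma
  shows integrable_taylor_forms:
      "integrable \<mu> (\<lambda>y. taylor_form k f x (y - x) * taylor_form l v x (y - x))"
    and integral_taylor_forms:
      "(\<integral>y. taylor_form k f x (y - x) * taylor_form l v x (y - x) \<partial>\<mu>) =
       (\<Sum>js\<in>words k. \<Sum>ks\<in>words l. iter_deriv js f x / fact k * (iter_deriv ks v x / fact l) *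
          (\<integral>y. monomial (js @ ks) (y - x) \<partial>\<mu>))"
proof -
  have eq: "taylor_form k f x z * taylor_form l v x z =
      (\<Sum>js\<in>words k. \<Sum>ks\<in>words l. iter_deriv js f x / fact k * (iter_deriv ks v x / fact l) *
        monomial (js @ ks) z)" for z
    unfolding taylor_form_def sum_product
    by (intro sum.cong refl) (simp only: monomial_append mult_ac)
  show "integrable \<mu> (\<lambda>y. taylor_form k f x (y - x) * taylor_form l v x (y - x))"
    unfolding eq by (intro Bochner_Integration.integrable_sum integrable_mult_right integrable_monomial)
  show "(\<integral>y. taylor_form k f x (y - x) * taylor_form l v x (y - x) \<partial>\<mu>) =
       (\<Sum>js\<in>words k. \<Sum>ks\<in>words l. iter_deriv js f x / fact k * (iter_deriv ks v x / fact l) *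
          (\<integral>y. monomial (js @ ks) (y - x) \<partial>\<mu>))"
    unfolding eq by (simp only: Bochner_Integration.integral_sum Bochner_Integration.integrable_sum
      integrable_mult_right integrable_monomial integral_mult_right_zero)
qed

lemma integral_taylor_forms_odd:
  assumes "k + l = 1 \<or> k + l = 3"
  shows "(\<integral>y. taylor_form k f x (y - x) * taylor_form l v x (y - x) \<partial>\<mu>) = 0"
  unfolding integral_taylor_forms using assms odd_moments
  by (intro sum.neutral ballI) auto

lemma integral_taylor_forms_0_2:
  "(\<integral>y. taylor_form 0 f x (y - x) * taylor_form 2 v x (y - x) \<partial>\<mu>) =
   f x * (\<Sum>i\<in>UNIV. iter_deriv [i, i] v x) / 2"
  unfolding integral_taylor_forms sum_words_0 sum_words_2
  by (simp only: append_Nil second_moments)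
     (simp add: of_bool_def if_distrib sum_distrib_left sum_divide_distrib cong: if_cong)

lemma integral_taylor_forms_1_1:
  "(\<integral>y. taylor_form 1 f x (y - x) * taylor_form 1 v x (y - x) \<partial>\<mu>) =
   (\<Sum>i\<in>UNIV. partial_deriv i f x * partial_deriv i v x)"
  unfolding integral_taylor_forms sum_words_1
  by (simp only: append_Cons append_Nil second_moments)
     (simp add: of_bool_def if_distrib cong: if_cong)

end

section \<open>Second-order consistency\<close>

context isotropic_measure
begin

text \<open>The support condition |y - x| < \<delta> trades two of the four powers for \<delta>^2,
  and the remaining second moment is exactly d. This is the origin of the order \<delta>^2.\<close>

lemma integral_norm_power4: "(\<integral>y. norm (y - x) ^ 4 \<partial>\<mu>) \<le> real CARD('n) * \<delta>\<^sup>2"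
proof -
  have "(\<integral>y. norm (y - x) ^ 4 \<partial>\<mu>) \<le> (\<integral>y. \<delta>\<^sup>2 * (norm (y - x))\<^sup>2 \<partial>\<mu>)"
  proof (intro integral_mono integrable_norm_power integrable_mult_right)
    fix y assume "y \<in> space \<mu>"
    then have "(norm (y - x))\<^sup>2 \<le> \<delta>\<^sup>2"
      using norm_less[of y] by (intro power_mono) auto
    then show "norm (y - x) ^ 4 \<le> \<delta>\<^sup>2 * (norm (y - x))\<^sup>2"
      using mult_right_mono[of "(norm (y - x))\<^sup>2" "\<delta>\<^sup>2" "(norm (y - x))\<^sup>2"]
      by (simp flip: power_add)
  qed
  then show ?thesis
    by (simp add: integral_norm_square mult.commute)
qed

lemma integrable_increment:
  fixes f v :: "real^'n \<Rightarrow> real"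
  assumes "continuous_on (ball x \<delta>) f" "\<And>y. y \<in> ball x \<delta> \<Longrightarrow> \<bar>f y\<bar> \<le> M"
    and "continuous_on (ball x \<delta>) v" "\<And>y. y \<in> ball x \<delta> \<Longrightarrow> \<bar>v y\<bar> \<le> N"
  shows "integrable \<mu> (\<lambda>y. f y * (v y - v x))"
proof (rule integrable_continuous_bounded)
  show "continuous_on (ball x \<delta>) (\<lambda>y. f y * (v y - v x))"
    using assms by (intro continuous_intros)
  fix y assume y: "y \<in> ball x \<delta>"
  have "\<bar>v y - v x\<bar> \<le> 2 * N"
    using assms(4)[OF y] assms(4)[of x] \<delta>_pos by simp
  then show "\<bar>f y * (v y - v x)\<bar> \<le> M * (2 * N)"
    unfolding abs_mult using assms(2)[OF y] by (intro mult_mono) auto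
qed

text \<open>In the product of the expansions of f and v - v(x), degrees 1 and 3 integrate to 0,
  degree 2 gives the differential operator, and the rest is of degree 4. The constant 8 d^5 combines
  four remainder terms of size d^4 M N |y - x|^4, a factor d from
  \<open>integral_norm_power4\<close> and the factor 2 of the operator. Order 3 is enough for f
  because v - v(x) already contributes one degree.\<close>

lemma consistency:
  fixes f v :: "real^'n \<Rightarrow> real"
  assumes f: "Ck_bounded_on 3 (ball x \<delta>) M f" and v: "Ck_bounded_on 4 (ball x \<delta>) N v"
  shows "\<bar>2 * (\<integral>y. f y * (v y - v x) \<partial>\<mu>) -
      (f x * (\<Sum>i\<in>UNIV. iter_deriv [i, i] v x) +
       2 * (\<Sum>i\<in>UNIV. partial_deriv i f x * partial_deriv i v x))\<bar>
      \<le> 8 * real CARD('n) ^ 5 * M * N * \<delta>\<^sup>2"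
proof -
  define d where "d = real CARD('n)"
  define F where "F k y = taylor_form k f x (y - x)" for k y
  define V where "V k y = taylor_form k v x (y - x)" for k y
  have x: "x \<in> ball x \<delta>"
    using \<delta>_pos by simp
  have M: "0 \<le> M" and N: "0 \<le> N"
    using Ck_bounded_onD(3)[OF f _ x, of "[]"] Ck_bounded_onD(3)[OF v _ x, of "[]"] by auto
  have [simp]: "\<And>y. F 0 y = f x" "\<And>y. V 0 y = v x"
    by (simp_all add: F_def V_def taylor_form_0)
  \<comment> \<open>All products of Taylor terms of total degree at most 3.\<close>
  define P where "P y = F 0 y * V 1 y + F 0 y * V 2 y + F 1 y * V 1 y +
      F 0 y * V 3 y + F 1 y * V 2 y + F 2 y * V 1 y" for y
  define Q where "Q y = f y * (v y - v x) - P y" for y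
  have Q: "\<bar>Q y\<bar> \<le> 4 * d ^ 4 * M * N * norm (y - x) ^ 4" if "y \<in> space \<mu>" for y
  proof -
    have y: "y \<in> ball x \<delta>"
      using that space_subset by blast
    have seg: "closed_segment x (x + (y - x)) \<subseteq> ball x \<delta>"
      using x y by (simp add: closed_segment_subset)
    have "\<bar>f y\<bar> \<le> M"
      using Ck_bounded_onD(3)[OF f _ y, of "[]"] by simp
    have Rf: "\<bar>f y - (\<Sum>k<n. F k y)\<bar> \<le> d ^ n * M * norm (y - x) ^ n" if "0 < n" "n \<le> 3" for n
      using taylor_bound[OF Ck_bounded_on_le[OF f \<open>n \<le> 3\<close>] seg \<open>0 < n\<close>]
      by (simp add: F_def d_def)
    have Rv: "\<bar>v y - (\<Sum>k<4. V k y)\<bar> \<le> d ^ 4 * N * norm (y - x) ^ 4"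
      using taylor_bound[OF v seg] by (simp add: V_def d_def)
    have Vk: "\<bar>V k y\<bar> \<le> d ^ k * N * norm (y - x) ^ k" if "k \<le> 4" for k
      unfolding V_def d_def using that x by (intro abs_taylor_form_le Ck_bounded_onD(3)[OF v]) auto
    have sums: "(\<Sum>k<1. F k y) = f x" "(\<Sum>k<2. F k y) = f x + F 1 y"
      "(\<Sum>k<3. F k y) = f x + F 1 y + F 2 y" "(\<Sum>k<4. V k y) = v x + V 1 y + V 2 y + V 3 y"
      by (simp_all add: eval_nat_numeral)
    \<comment> \<open>Telescoping: the remainder of f of order 4 - k is paired with the degree-k
      term of v, and the remainder of v of order 4 with f itself.\<close>
    have Q: "Q y = f y * (v y - (\<Sum>k<4. V k y)) + (f y - (\<Sum>k<3. F k y)) * V 1 y +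
        (f y - (\<Sum>k<2. F k y)) * V 2 y + (f y - (\<Sum>k<1. F k y)) * V 3 y"
      unfolding Q_def P_def sums by (simp only: \<open>\<And>y. F 0 y = f x\<close>) (simp add: algebra_simps)
    have "\<bar>Q y\<bar> \<le> \<bar>f y * (v y - (\<Sum>k<4. V k y))\<bar> + \<bar>(f y - (\<Sum>k<3. F k y)) * V 1 y\<bar> +
        \<bar>(f y - (\<Sum>k<2. F k y)) * V 2 y\<bar> + \<bar>(f y - (\<Sum>k<1. F k y)) * V 3 y\<bar>"
      unfolding Q by linarith
    also have "\<dots> \<le> M * (d ^ 4 * N * norm (y - x) ^ 4) +
        (d ^ 3 * M * norm (y - x) ^ 3) * (d ^ 1 * N * norm (y - x) ^ 1) +
        (d ^ 2 * M * norm (y - x) ^ 2) * (d ^ 2 * N * norm (y - x) ^ 2) +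
        (d ^ 1 * M * norm (y - x) ^ 1) * (d ^ 3 * N * norm (y - x) ^ 3)"
    proof -
      have *: "\<bar>a * b\<bar> \<le> A * B" if "\<bar>a\<bar> \<le> A" "\<bar>b\<bar> \<le> B" for a b A B :: real
        unfolding abs_mult using that by (intro mult_mono) auto
      show ?thesis
        using \<open>\<bar>f y\<bar> \<le> M\<close> Rv by (intro add_mono * Rf Vk) auto
    qed
    also have "\<dots> = 4 * d ^ 4 * M * N * norm (y - x) ^ 4"
      by (simp add: eval_nat_numeral algebra_simps)
    finally show ?thesis .
  qed
  have int: "integrable \<mu> (\<lambda>y. f y * (v y - v x))"
    using Ck_bounded_onD(2,3)[OF f, of "[]"] Ck_bounded_onD(2,3)[OF v, of "[]"]
    by (intro integrable_increment[of f M v N]) auto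
  have FV [simp]: "integrable \<mu> (\<lambda>y. F k y * V l y)" for k l
    unfolding F_def V_def by (rule integrable_taylor_forms)
  have intP: "integrable \<mu> P"
    unfolding P_def by (intro Bochner_Integration.integrable_add FV)
  have odd: "(\<integral>y. F 0 y * V 1 y \<partial>\<mu>) = 0" "(\<integral>y. F 0 y * V 3 y \<partial>\<mu>) = 0"
    "(\<integral>y. F 1 y * V 2 y \<partial>\<mu>) = 0" "(\<integral>y. F 2 y * V 1 y \<partial>\<mu>) = 0"
    unfolding F_def V_def by (rule integral_taylor_forms_odd; simp)+
  have even: "(\<integral>y. F 0 y * V 2 y \<partial>\<mu>) = f x * (\<Sum>i\<in>UNIV. iter_deriv [i, i] v x) / 2"
    "(\<integral>y. F 1 y * V 1 y \<partial>\<mu>) = (\<Sum>i\<in>UNIV. partial_deriv i f x * partial_deriv i v x)"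
    unfolding F_def V_def by (rule integral_taylor_forms_0_2 integral_taylor_forms_1_1)+
  have "integral\<^sup>L \<mu> P = (\<integral>y. F 0 y * V 1 y \<partial>\<mu>) + (\<integral>y. F 0 y * V 2 y \<partial>\<mu>) +
      (\<integral>y. F 1 y * V 1 y \<partial>\<mu>) + (\<integral>y. F 0 y * V 3 y \<partial>\<mu>) + (\<integral>y. F 1 y * V 2 y \<partial>\<mu>) +
      (\<integral>y. F 2 y * V 1 y \<partial>\<mu>)"
    unfolding P_def by (simp only: Bochner_Integration.integral_add Bochner_Integration.integrable_add FV)
  also have "\<dots> = f x * (\<Sum>i\<in>UNIV. iter_deriv [i, i] v x) / 2 +
      (\<Sum>i\<in>UNIV. partial_deriv i f x * partial_deriv i v x)"
    by (simp only: odd even)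
  finally have P: "2 * integral\<^sup>L \<mu> P = f x * (\<Sum>i\<in>UNIV. iter_deriv [i, i] v x) +
      2 * (\<Sum>i\<in>UNIV. partial_deriv i f x * partial_deriv i v x)"
    by simp
  have "\<bar>integral\<^sup>L \<mu> Q\<bar> \<le> (\<integral>y. 4 * d ^ 4 * M * N * norm (y - x) ^ 4 \<partial>\<mu>)"
  proof (rule Bochner_Integration.integral_abs_bound_integral)
    show "integrable \<mu> Q"
      unfolding Q_def using int intP by (rule Bochner_Integration.integrable_diff)
  qed (auto intro!: Q)
  also have "\<dots> \<le> 4 * d ^ 4 * M * N * (d * \<delta>\<^sup>2)"
    using integral_norm_power4 M N by (simp add: d_def mult_left_mono)
  finally have "\<bar>integral\<^sup>L \<mu> Q\<bar> \<le> 4 * d ^ 5 * M * N * \<delta>\<^sup>2"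
    by (simp add: eval_nat_numeral mult_ac)
  moreover have "integral\<^sup>L \<mu> Q = (\<integral>y. f y * (v y - v x) \<partial>\<mu>) - integral\<^sup>L \<mu> P"
    unfolding Q_def using int intP by (rule Bochner_Integration.integral_diff)
  ultimately show ?thesis
    unfolding P[symmetric] d_def[symmetric] by linarith
qed

end

section \<open>Barrier and maximum principle\<close>

text \<open>The Lagrange remainder is exp(u) t^2 / 2 with |u| \<le> 1, and exp(-1) \<ge> 1/3 because
  e \<le> 3; hence the constant 1/6.\<close>

lemma exp_ge_quadratic:
  fixes t :: real
  assumes "\<bar>t\<bar> \<le> 1"
  shows "1 + t + t\<^sup>2 / 6 \<le> exp t"
proof -
  obtain u where u: "\<bar>u\<bar> \<le> \<bar>t\<bar>" and eq: "exp t = (\<Sum>m<2. t ^ m / fact m) + exp u / fact 2 * t\<^sup>2"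
    using Maclaurin_exp_le[of t 2] by blast
  have "1 / 3 \<le> exp (- 1 :: real)"
    using exp_le by (simp add: exp_minus field_simps)
  also have "\<dots> \<le> exp u"
    using u assms by simp
  finally have "1 / 6 * t\<^sup>2 \<le> exp u / fact 2 * t\<^sup>2"
    by (intro mult_right_mono) auto
  then show ?thesis
    by (simp add: eq eval_nat_numeral)
qed

context isotropic_measure
begin

text \<open>A steep exponential is a strict subsolution: its second-order part, of size \<open>l\<^sup>2\<close>,
  dominates the drift caused by the variation of \<open>f\<close>, which is of size \<open>l\<close> only.\<close>

lemma barrier:
  fixes f :: "real^'n \<Rightarrow> real" and i :: 'n
  assumes f: "Ck_bounded_on 1 (ball x \<delta>) M f" and r: "\<And>y. y \<in> ball x \<delta> \<Longrightarrow> r \<le> f y"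
    and "0 < r" and l: "1 \<le> l" "l * \<delta> \<le> 1" "1 + (real CARD('n))\<^sup>2 * M \<le> r * l / 6"
    and b: "0 \<le> x $ i + b"
  defines "g \<equiv> \<lambda>y. exp (l * (y $ i + b))"
  shows "integrable \<mu> (\<lambda>y. f y * (g y - g x))" and "1 \<le> (\<integral>y. f y * (g y - g x) \<partial>\<mu>)"
proof -
  define d where "d = real CARD('n)"
  have x: "x \<in> ball x \<delta>"
    using \<delta>_pos by simp
  have M: "0 \<le> M"
    using Ck_bounded_onD(3)[OF f _ x, of "[]"] by auto
  have small: "\<bar>l * (y - x) $ i\<bar> \<le> 1" if "y \<in> ball x \<delta>" for y
  proof -
    have "\<bar>(y - x) $ i\<bar> \<le> \<delta>"
      using that component_le_norm_cart[of "y - x" i] by (simp add: dist_norm norm_minus_commute)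
    then have "l * \<bar>(y - x) $ i\<bar> \<le> l * \<delta>"
      using l by (intro mult_left_mono) auto
    also note l(2)
    finally show ?thesis
      using l(1) by (simp add: abs_mult)
  qed
  have g: "g y = g x * exp (l * (y - x) $ i)" for y
    by (simp add: g_def algebra_simps flip: exp_add)
  have "1 \<le> g x"
    using b l by (simp add: g_def)
  show int: "integrable \<mu> (\<lambda>y. f y * (g y - g x))"
  proof (rule integrable_increment)
    show "continuous_on (ball x \<delta>) f" "\<And>y. y \<in> ball x \<delta> \<Longrightarrow> \<bar>f y\<bar> \<le> M"
      using Ck_bounded_onD(2,3)[OF f, of "[]"] by auto
    show "continuous_on (ball x \<delta>) g"
      unfolding g_def by (intro continuous_intros)
    show "\<bar>g y\<bar> \<le> g x * exp 1" if "y \<in> ball x \<delta>" for y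
      unfolding g[of y] using small[OF that] by (simp add: g_def)
  qed
  \<comment> \<open>A pointwise minorant whose integral is known from the moments: the linear term
    integrates to 0, replacing f(y) by f(x) in it costs d^2 M l, and the quadratic term gains r l^2
    / 6.\<close>
  define p where "p y = f x * l * monomial [i] (y - x) - d * M * l * (norm (y - x))\<^sup>2 +
      r * l\<^sup>2 / 6 * monomial [i, i] (y - x)" for y
  have le: "p y \<le> f y * (exp (l * (y - x) $ i) - 1)" if y: "y \<in> space \<mu>" for y
  proof -
    have y: "y \<in> ball x \<delta>"
      using that space_subset by blast
    define t where "t = l * (y - x) $ i"
    have "closed_segment x (x + (y - x)) \<subseteq> ball x \<delta>"
      using x y by (simp add: closed_segment_subset)
    then have "\<bar>f y - f x\<bar> \<le> d * M * norm (y - x)"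
      using taylor_bound[OF f, of x "y - x"] by (simp add: taylor_form_0 d_def)
    moreover have "\<bar>t\<bar> \<le> l * norm (y - x)"
      using component_le_norm_cart[of "y - x" i] l by (simp add: t_def abs_mult)
    ultimately have "\<bar>(f y - f x) * t\<bar> \<le> d * M * norm (y - x) * (l * norm (y - x))"
      unfolding abs_mult by (intro mult_mono) (auto simp: d_def M)
    \<comment> \<open>The term t has no sign, so the lower bound \<open>r\<close> is useless here;
      f(y) is compared with f(x) through its Lipschitz bound d M.\<close>
    then have 1: "f x * t - d * M * l * (norm (y - x))\<^sup>2 \<le> f y * t"
      by (simp add: algebra_simps power2_eq_square)
    have 2: "r * (t\<^sup>2 / 6) \<le> f y * (t\<^sup>2 / 6)"
      using r[OF y] by (intro mult_right_mono) auto
    have "f y * (t + t\<^sup>2 / 6) \<le> f y * (exp t - 1)"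
      using exp_ge_quadratic[of t] small[OF y] r[OF y] \<open>0 < r\<close>
      by (intro mult_left_mono) (auto simp: t_def)
    with 1 2 have "f x * t - d * M * l * (norm (y - x))\<^sup>2 + r * (t\<^sup>2 / 6) \<le> f y * (exp t - 1)"
      by (simp add: distrib_left)
    moreover have "p y = f x * t - d * M * l * (norm (y - x))\<^sup>2 + r * (t\<^sup>2 / 6)"
      by (simp add: p_def t_def power2_eq_square)
    ultimately show ?thesis
      by (simp add: t_def)
  qed
  have "(\<integral>y. p y \<partial>\<mu>) = f x * l * (\<integral>y. monomial [i] (y - x) \<partial>\<mu>) -
      d * M * l * (\<integral>y. (norm (y - x))\<^sup>2 \<partial>\<mu>) + r * l\<^sup>2 / 6 * (\<integral>y. monomial [i, i] (y - x) \<partial>\<mu>)"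
    unfolding p_def by (simp only: Bochner_Integration.integral_add Bochner_Integration.integral_diff
        Bochner_Integration.integrable_add Bochner_Integration.integrable_diff integrable_mult_right
        integrable_monomial integrable_norm_power integral_mult_right_zero)
  also have "\<dots> = l * (r * l / 6 - d\<^sup>2 * M)"
    using odd_moments[of "[i]"] second_moments[of i i] integral_norm_square
    by (simp add: d_def power2_eq_square algebra_simps del: monomial_Cons)
  finally have p: "(\<integral>y. p y \<partial>\<mu>) = l * (r * l / 6 - d\<^sup>2 * M)" .
  have "1 \<le> l * (r * l / 6 - d\<^sup>2 * M)"
    using mult_mono[of 1 l 1 "r * l / 6 - d\<^sup>2 * M"] l by (simp add: d_def)
  also have "\<dots> = (\<integral>y. p y \<partial>\<mu>)"
    using p ..
  also have "\<dots> \<le> (\<integral>y. f y * (exp (l * (y - x) $ i) - 1) \<partial>\<mu>)"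
  proof (intro integral_mono le)
    show "integrable \<mu> p"
      unfolding p_def by (intro Bochner_Integration.integrable_add Bochner_Integration.integrable_diff
          integrable_mult_right integrable_monomial integrable_norm_power)
    have "f y * (exp (l * (y - x) $ i) - 1) = f y * (g y - g x) / g x" for y
      using \<open>1 \<le> g x\<close> by (simp add: g[of y] field_simps)
    then show "integrable \<mu> (\<lambda>y. f y * (exp (l * (y - x) $ i) - 1))"
      using int by simp
  qed
  \<comment> \<open>Here g(x) \<ge> 1 is used, which rests on x_i + b \<ge> 0.\<close>
  also have "\<dots> \<le> g x * \<dots>"
    using calculation mult_right_mono[OF \<open>1 \<le> g x\<close>] by simp
  also have "\<dots> = (\<integral>y. f y * (g y - g x) \<partial>\<mu>)"
  proof -
    have "f y * (g y - g x) = g x * (f y * (exp (l * (y - x) $ i) - 1))" for y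
      by (simp add: g[of y] algebra_simps)
    then show ?thesis
      by (simp only: integral_mult_right_zero)
  qed
  finally show "1 \<le> (\<integral>y. f y * (g y - g x) \<partial>\<mu>)" .
qed

end

text \<open>If the bound failed, w = e + \<eta> (g - E) would have a positive maximum. Since w \<le>
  0 off \<Omega>, it is attained at some x in \<Omega>, where \<open>0 \<le> A x y\<close> makes the
  operator applied to w nonpositive. But the barrier contributes at least 2 \<eta> and e at least
  -\<eta>, a contradiction.\<close>

lemma nonlocal_maximum_principle:
  fixes e :: "real^'n::finite \<Rightarrow> real" and A :: "real^'n \<Rightarrow> real^'n \<Rightarrow> real" and i :: 'n
  assumes compact: "compact (Y \<inter> closure \<Omega>)" and cont: "continuous_on (Y \<inter> closure \<Omega>) e"
    and iso: "\<And>x. x \<in> Y \<inter> \<Omega> \<Longrightarrow> isotropic_measure (\<mu> x) x \<delta>"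
    and space: "\<And>x. x \<in> Y \<inter> \<Omega> \<Longrightarrow> space (\<mu> x) \<subseteq> Y"
    and A: "\<And>x. x \<in> Y \<inter> \<Omega> \<Longrightarrow> Ck_bounded_on 1 (ball x \<delta>) M (A x)"
    and r: "\<And>x y. x \<in> Y \<inter> \<Omega> \<Longrightarrow> y \<in> ball x \<delta> \<Longrightarrow> r \<le> A x y" "0 < r"
    and l: "1 \<le> l" "l * \<delta> \<le> 1" "1 + (real CARD('n))\<^sup>2 * M \<le> r * l / 6"
    and b: "\<And>y. y \<in> Y \<Longrightarrow> \<bar>y $ i\<bar> \<le> b"
    and e0: "\<And>y. y \<in> Y - \<Omega> \<Longrightarrow> e y = 0"
    and int: "\<And>x. x \<in> Y \<inter> \<Omega> \<Longrightarrow> integrable (\<mu> x) (\<lambda>y. A x y * (e y - e x))"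
    and le: "\<And>x. x \<in> Y \<inter> \<Omega> \<Longrightarrow> - \<eta> \<le> 2 * (\<integral>y. A x y * (e y - e x) \<partial>\<mu> x)"
    and "0 < \<eta>" and y0: "y0 \<in> Y"
  shows "e y0 \<le> \<eta> * exp (2 * l * b)"
proof (rule ccontr)
  define g where "g y = exp (l * (y $ i + b))" for y :: "real^'n"
  \<comment> \<open>The supremum bound for the barrier on \<open>Y\<close>, as y_i + b \<le> 2 b
    there; subtracting it makes the barrier nonpositive.\<close>
  define E where "E = exp (2 * l * b)"
  define w where "w y = e y + \<eta> * (g y - E)" for y
  have gE: "g y \<le> E" if "y \<in> Y" for y
    using b[OF that] l by (simp add: g_def E_def)
  assume "\<not> e y0 \<le> \<eta> * exp (2 * l * b)"
  moreover have "0 < \<eta> * g y0"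
    using \<open>0 < \<eta>\<close> by (simp add: g_def)
  ultimately have "0 < w y0"
    unfolding w_def E_def right_diff_distrib by linarith
  have outside: "w y \<le> 0" if "y \<in> Y - \<Omega>" for y
    using that e0[OF that] gE[of y] \<open>0 < \<eta>\<close> by (simp add: w_def mult_le_0_iff)
  have "y0 \<in> \<Omega>"
    using outside[of y0] y0 \<open>0 < w y0\<close> by auto
  then have y0': "y0 \<in> Y \<inter> closure \<Omega>"
    using y0 closure_subset by blast
  have "continuous_on (Y \<inter> closure \<Omega>) w"
    unfolding w_def g_def by (intro continuous_intros cont)
  then obtain x where x: "x \<in> Y \<inter> closure \<Omega>" and max: "\<And>y. y \<in> Y \<inter> closure \<Omega> \<Longrightarrow> w y \<le> w x"
    using continuous_attains_sup[OF compact, of w] y0' by blast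
  have "0 < w x"
    using max[OF y0'] \<open>0 < w y0\<close> by simp
  then have x\<Omega>: "x \<in> Y \<inter> \<Omega>"
    using outside[of x] x by auto
  \<comment> \<open>The measure at x may charge points outside \<Omega>, so maximality is needed on
    all of \<open>Y\<close>; off \<Omega> it holds because w \<le> 0 < w(x).\<close>
  have max': "w y \<le> w x" if "y \<in> Y" for y
    using that max[of y] outside[of y] \<open>0 < w x\<close> closure_subset[of \<Omega>] by (cases "y \<in> \<Omega>") auto
  interpret isotropic_measure "\<mu> x" x \<delta>
    using iso[OF x\<Omega>] .
  have "0 \<le> x $ i + b"
    using b[of x] x by auto
  note barrier = barrier[OF A[OF x\<Omega>] r(1)[OF x\<Omega>] r(2) l this, folded g_def]
  have "(\<integral>y. A x y * (e y - e x) \<partial>\<mu> x) + \<eta> * (\<integral>y. A x y * (g y - g x) \<partial>\<mu> x) =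
      (\<integral>y. A x y * (e y - e x) + \<eta> * (A x y * (g y - g x)) \<partial>\<mu> x)"
    using int[OF x\<Omega>] barrier(1) by simp
  also have "\<dots> = - (\<integral>y. A x y * (w x - w y) \<partial>\<mu> x)"
    unfolding integral_minus[symmetric]
    by (intro Bochner_Integration.integral_cong) (auto simp: w_def algebra_simps)
  finally have "(\<integral>y. A x y * (e y - e x) \<partial>\<mu> x) + \<eta> * (\<integral>y. A x y * (g y - g x) \<partial>\<mu> x) =
      - (\<integral>y. A x y * (w x - w y) \<partial>\<mu> x)" .
  moreover have "0 \<le> (\<integral>y. A x y * (w x - w y) \<partial>\<mu> x)"
  proof (rule Bochner_Integration.integral_nonneg)
    fix y assume y: "y \<in> space (\<mu> x)"
    then have "0 \<le> A x y"
      using r(1)[OF x\<Omega>, of y] r(2) space_subset by auto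
    moreover have "0 \<le> w x - w y"
      using max'[of y] space[OF x\<Omega>] y by auto
    ultimately show "0 \<le> A x y * (w x - w y)"
      by (rule mult_nonneg_nonneg)
  qed
  ultimately have "(\<integral>y. A x y * (e y - e x) \<partial>\<mu> x) + \<eta> * (\<integral>y. A x y * (g y - g x) \<partial>\<mu> x) \<le> 0"
    by simp
  moreover have "\<eta> \<le> \<eta> * (\<integral>y. A x y * (g y - g x) \<partial>\<mu> x)"
    using barrier(2) \<open>0 < \<eta>\<close> by simp
  ultimately show False
    using le[OF x\<Omega>] \<open>0 < \<eta>\<close> by simp
qed

lemma nonlocal_stability:
  fixes e :: "real^'n::finite \<Rightarrow> real" and A :: "real^'n \<Rightarrow> real^'n \<Rightarrow> real" and i :: 'n
  assumes compact: "compact (Y \<inter> closure \<Omega>)" and cont: "continuous_on (Y \<inter> closure \<Omega>) e"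
    and iso: "\<And>x. x \<in> Y \<inter> \<Omega> \<Longrightarrow> isotropic_measure (\<mu> x) x \<delta>"
    and space: "\<And>x. x \<in> Y \<inter> \<Omega> \<Longrightarrow> space (\<mu> x) \<subseteq> Y"
    and A: "\<And>x. x \<in> Y \<inter> \<Omega> \<Longrightarrow> Ck_bounded_on 1 (ball x \<delta>) M (A x)"
    and r: "\<And>x y. x \<in> Y \<inter> \<Omega> \<Longrightarrow> y \<in> ball x \<delta> \<Longrightarrow> r \<le> A x y" "0 < r"
    and l: "1 \<le> l" "l * \<delta> \<le> 1" "1 + (real CARD('n))\<^sup>2 * M \<le> r * l / 6"
    and b: "\<And>y. y \<in> Y \<Longrightarrow> \<bar>y $ i\<bar> \<le> b"
    and e0: "\<And>y. y \<in> Y - \<Omega> \<Longrightarrow> e y = 0"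
    and int: "\<And>x. x \<in> Y \<inter> \<Omega> \<Longrightarrow> integrable (\<mu> x) (\<lambda>y. A x y * (e y - e x))"
    and le: "\<And>x. x \<in> Y \<inter> \<Omega> \<Longrightarrow> \<bar>2 * (\<integral>y. A x y * (e y - e x) \<partial>\<mu> x)\<bar> \<le> \<eta>"
    and "0 < \<eta>" and y: "y \<in> Y"
  shows "\<bar>e y\<bar> \<le> \<eta> * exp (2 * l * b)"
proof (rule abs_leI)
  show "e y \<le> \<eta> * exp (2 * l * b)"
    by (rule nonlocal_maximum_principle[OF compact cont iso space A r l b e0 int _ \<open>0 < \<eta>\<close> y])
       (use le in force)+
  have neg: "A x y * (- e y - - e x) = - (A x y * (e y - e x))" for x y
    by (simp add: algebra_simps)
  show "- e y \<le> \<eta> * exp (2 * l * b)"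
  proof (rule nonlocal_maximum_principle[OF compact _ iso space A r l b _ _ _ \<open>0 < \<eta>\<close> y])
    show "continuous_on (Y \<inter> closure \<Omega>) (\<lambda>y. - e y)"
      by (intro continuous_intros cont)
    show "integrable (\<mu> x) (\<lambda>y. A x y * (- e y - - e x))" if "x \<in> Y \<inter> \<Omega>" for x
      unfolding neg using int[OF that] by simp
    show "- \<eta> \<le> 2 * (\<integral>y. A x y * (- e y - - e x) \<partial>\<mu> x)" if "x \<in> Y \<inter> \<Omega>" for x
      unfolding neg using le[OF that] by simp
  qed (auto simp: e0)
qed

section \<open>The local operator and the geometry of the grid\<close>

text \<open>Without joint differentiability of \<open>A\<close>, the first-order part of \<open>A (x + t) (x + t) - A x x\<close>
  is obtained from two second-order expansions in one variable each; they match in the limit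
  because the partial derivative in the second variable, a uniform limit of difference quotients,
  is continuous in the first one.\<close>

lemma partial_deriv_diagonal:
  fixes A :: "real^'n::finite \<Rightarrow> real^'n \<Rightarrow> real"
  assumes V: "open V" "x \<in> V"
    and sym: "\<And>y z. y \<in> V \<Longrightarrow> z \<in> V \<Longrightarrow> A y z = A z y"
    and cont: "continuous_on (V \<times> V) (\<lambda>(y, z). A y z)"
    and C2: "\<And>y. y \<in> V \<Longrightarrow> Ck_bounded_on 2 V M (A y)"
    and diff: "(\<lambda>y. A y y) differentiable (at x)"
  shows "partial_deriv i (\<lambda>y. A y y) x = 2 * partial_deriv i (A x) x"
proof -
  obtain \<rho> where "0 < \<rho>" and \<rho>: "ball x \<rho> \<subseteq> V"
    using V openE by blast
  define e :: "real^'n" where "e = axis i 1"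
  define K where "K = (real CARD('n))\<^sup>2 * M"
  \<comment> \<open>The slope in the second argument at x, after the first argument has moved to x +
    t e.\<close>
  define G where "G t = partial_deriv i (A (x + t *\<^sub>R e)) x" for t
  have e: "norm (t *\<^sub>R e) = \<bar>t\<bar>" for t
    by (simp add: e_def)
  have component: "(\<Sum>j\<in>UNIV. (t *\<^sub>R e) $ j * g j) = t * g i" for t :: real and g
  proof -
    have "(\<Sum>j\<in>UNIV. (t *\<^sub>R e) $ j * g j) = (\<Sum>j\<in>UNIV. if j = i then t * g j else 0)"
      by (intro sum.cong) (auto simp: e_def axis_def)
    then show ?thesis
      by simp
  qed
  have inV: "x + t *\<^sub>R e \<in> V" if "\<bar>t\<bar> < \<rho>" for t
    using that e[of t] \<rho> by (auto simp: dist_norm subset_iff)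
  have "0 \<le> M"
    using Ck_bounded_onD(3)[OF C2[OF V(2)] _ V(2), of "[]"] by auto
  then have "0 \<le> K"
    by (simp add: K_def)
  have taylor: "\<bar>A y (x + t *\<^sub>R e) - A y x - t * partial_deriv i (A y) x\<bar> \<le> K * t\<^sup>2"
    if "y \<in> V" "\<bar>t\<bar> < \<rho>" for y t
  proof -
    have "closed_segment x (x + t *\<^sub>R e) \<subseteq> ball x \<rho>"
      using that e[of t] \<open>0 < \<rho>\<close> by (intro closed_segment_subset) (auto simp: dist_norm)
    then have "\<bar>A y (x + t *\<^sub>R e) - (\<Sum>k<2. taylor_form k (A y) x (t *\<^sub>R e))\<bar> \<le> K * \<bar>t\<bar>\<^sup>2"
      using taylor_bound[OF C2[OF \<open>y \<in> V\<close>], of x "t *\<^sub>R e"] \<rho> e[of t] by (auto simp: K_def)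
    moreover have "taylor_form 1 (A y) x (t *\<^sub>R e) = t * partial_deriv i (A y) x"
      unfolding taylor_form_1 by (rule component)
    ultimately show ?thesis
      by (simp add: numeral_2_eq_2 taylor_form_0)
  qed
  have lim: "((\<lambda>t. A (x + t *\<^sub>R e) p) \<longlongrightarrow> A x p) (at 0)" if "p \<in> V" for p
  proof -
    have "continuous (at (x, p)) (\<lambda>(y, z). A y z)"
      using cont V that by (simp add: continuous_on_eq_continuous_at open_Times)
    moreover have "((\<lambda>t. (x + t *\<^sub>R e, p)) \<longlongrightarrow> (x + 0 *\<^sub>R e, p)) (at 0)"
      by (intro tendsto_intros)
    ultimately show ?thesis
      using isCont_tendsto_compose[of "(x, p)" "\<lambda>(y, z). A y z" "\<lambda>t. (x + t *\<^sub>R e, p)"] by simp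
  qed
  have G: "(G \<longlongrightarrow> G 0) (at 0)"
  proof (rule tendstoI)
    fix \<epsilon> :: real assume "0 < \<epsilon>"
    \<comment> \<open>Difference quotients of step \<tau> differ from \<open>G t\<close> and from
      \<open>G 0\<close> by at most K \<tau> < \<epsilon>/4 each, uniformly in t. Continuity in the
      first argument at the two points x and x + \<tau> e, with tolerance \<epsilon> \<tau> / 4
      each, supplies the other half of \<epsilon>. Using K + 1 keeps the quotient defined when K =
      0.\<close>
    define \<tau> where "\<tau> = min (\<rho> / 2) (\<epsilon> / (4 * (K + 1)))"
    have \<tau>: "0 < \<tau>" "\<bar>\<tau>\<bar> < \<rho>"
      using \<open>0 < \<rho>\<close> \<open>0 < \<epsilon>\<close> \<open>0 \<le> K\<close> by (auto simp: \<tau>_def)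
    have "\<tau> \<le> \<epsilon> / (4 * (K + 1))"
      by (simp add: \<tau>_def)
    then have "\<tau> * (4 * (K + 1)) \<le> \<epsilon>"
      using \<open>0 \<le> K\<close> by (simp add: pos_le_divide_eq)
    then have K\<tau>: "4 * (K * \<tau>) < \<epsilon>"
      using \<tau>(1) by (simp add: algebra_simps)
    have "\<forall>\<^sub>F t in at 0. dist (A (x + t *\<^sub>R e) p) (A x p) < \<epsilon> * \<tau> / 4" if "p \<in> V" for p
      using \<open>0 < \<epsilon>\<close> \<tau> by (intro tendstoD[OF lim[OF that]]) auto
    from this[OF inV[OF \<tau>(2)]] this[OF V(2)]
    have "\<forall>\<^sub>F t in at 0. \<bar>A (x + t *\<^sub>R e) (x + \<tau> *\<^sub>R e) - A x (x + \<tau> *\<^sub>R e)\<bar> < \<epsilon> * \<tau> / 4 \<and>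
        \<bar>A (x + t *\<^sub>R e) x - A x x\<bar> < \<epsilon> * \<tau> / 4 \<and> \<bar>t\<bar> < \<rho>"
      using eventually_at_ball[OF \<open>0 < \<rho>\<close>, of 0 UNIV]
      by eventually_elim (simp add: dist_real_def)
    then show "\<forall>\<^sub>F t in at 0. dist (G t) (G 0) < \<epsilon>"
    proof eventually_elim
      case (elim t)
      have "\<bar>\<tau> * (G t - G 0)\<bar> < \<epsilon> * \<tau> / 4 + \<epsilon> * \<tau> / 4 + 2 * (K * \<tau>\<^sup>2)"
      proof -
        have *: "\<bar>p - q\<bar> < a + a + 2 * c"
          if "\<bar>y - z\<bar> < a" "\<bar>y' - z'\<bar> < a" "\<bar>y - y' - p\<bar> \<le> c" "\<bar>z - z' - q\<bar> \<le> c"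
          for a c p q y y' z z' :: real
          using that unfolding abs_less_iff abs_le_iff by linarith
        have "\<bar>\<tau> * G t - \<tau> * G 0\<bar> < \<epsilon> * \<tau> / 4 + \<epsilon> * \<tau> / 4 + 2 * (K * \<tau>\<^sup>2)"
          using elim taylor[OF inV \<tau>(2), of t] taylor[OF V(2) \<tau>(2)] by (intro *) (auto simp: G_def)
        then show ?thesis
          by (simp only: right_diff_distrib)
      qed
      also have "\<dots> = (\<epsilon> / 2 + 2 * (K * \<tau>)) * \<tau>"
        by (simp add: power2_eq_square algebra_simps)
      also have "\<dots> < \<epsilon> * \<tau>"
        using K\<tau> \<tau>(1) by (intro mult_strict_right_mono) auto
      finally show ?case
        using \<tau>(1) by (simp add: abs_mult dist_real_def)
    qed
  qed
  \<comment> \<open>The difference quotient along the diagonal; its limit is computed twice, as 2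
    \<open>G 0\<close> and as the derivative of a.\<close>
  define q where "q t = (A (x + t *\<^sub>R e) (x + t *\<^sub>R e) - A x x) / t" for t
  have "((\<lambda>t. q t - (G t + G 0)) \<longlongrightarrow> 0) (at 0)"
  proof (rule tendsto_0_le[where K = "2 * K"])
    show "((\<lambda>t. t :: real) \<longlongrightarrow> 0) (at 0)"
      by (rule tendsto_ident_at)
    have "\<forall>\<^sub>F t in at 0. \<bar>t\<bar> < \<rho> \<and> t \<noteq> (0 :: real)"
      using eventually_at_ball[OF \<open>0 < \<rho>\<close>, of 0 UNIV] eventually_neq_at_within[of 0 0 UNIV]
      by eventually_elim (simp add: dist_real_def)
    then show "\<forall>\<^sub>F t in at 0. norm (q t - (G t + G 0)) \<le> norm t * (2 * K)"
    proof eventually_elim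
      case (elim t)
      have "t * q t = A (x + t *\<^sub>R e) (x + t *\<^sub>R e) - A x x"
        using elim by (simp add: q_def)
      \<comment> \<open>A(x + t e, x) is inserted in the middle; symmetry rewrites it as A(x, x + t
        e) in the second bracket, so both increments are in the second argument.\<close>
      then have "t * (q t - (G t + G 0)) =
          (A (x + t *\<^sub>R e) (x + t *\<^sub>R e) - A (x + t *\<^sub>R e) x - t * G t) +
          (A x (x + t *\<^sub>R e) - A x x - t * G 0)"
        using elim sym[OF V(2) inV, of t] by (simp add: right_diff_distrib distrib_left)
      then have "\<bar>t * (q t - (G t + G 0))\<bar> \<le> K * t\<^sup>2 + K * t\<^sup>2"
        using elim taylor[OF inV, of t t] taylor[OF V(2), of t] by (simp add: G_def)
      also have "\<dots> = t\<^sup>2 * (2 * K)"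
        by simp
      also have "t\<^sup>2 = \<bar>t\<bar> * \<bar>t\<bar>"
        by (simp add: power2_eq_square)
      finally have "\<bar>t\<bar> * \<bar>q t - (G t + G 0)\<bar> \<le> \<bar>t\<bar> * (\<bar>t\<bar> * (2 * K))"
        by (simp only: abs_mult mult.assoc)
      then show ?case
        using elim by simp
    qed
  qed
  then have "((\<lambda>t. q t - (G t + G 0) + (G t + G 0)) \<longlongrightarrow> 0 + (G 0 + G 0)) (at 0)"
    by (intro tendsto_add G tendsto_const)
  then have "(q \<longlongrightarrow> 2 * G 0) (at 0)"
    by simp
  moreover have "(q \<longlongrightarrow> partial_deriv i (\<lambda>y. A y y) x) (at 0)"
  proof -
    have "(\<Sum>j\<in>UNIV. e $ j * partial_deriv j (\<lambda>y. A y y) x) = partial_deriv i (\<lambda>y. A y y) x"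
      using component[of 1] by simp
    then have "((\<lambda>t. A (x + t *\<^sub>R e) (x + t *\<^sub>R e)) has_real_derivative
        partial_deriv i (\<lambda>y. A y y) x) (at 0)"
      using DERIV_along_line[of "\<lambda>y. A y y" x 0 e] diff by simp
    then show ?thesis
      by (simp add: DERIV_def q_def[abs_def])
  qed
  ultimately show ?thesis
    using LIM_unique[of q] by (auto simp: G_def)
qed

text \<open>The product rule. Together with \<open>partial_deriv_diagonal\<close> it brings the
  local operator into the form produced by \<open>consistency\<close>.\<close>

lemma local_op_expand:
  fixes u :: "real^'n::finite \<Rightarrow> real"
  assumes a: "a differentiable (at x)" and u: "\<And>i. partial_deriv i u differentiable (at x)"
  shows "local_op a u x =
    a x * (\<Sum>i\<in>UNIV. iter_deriv [i, i] u x) + (\<Sum>i\<in>UNIV. partial_deriv i a x * partial_deriv i u x)"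
proof -
  have "partial_deriv i (\<lambda>y. a y * partial_deriv i u y) x =
      a x * iter_deriv [i, i] u x + partial_deriv i a x * partial_deriv i u x" for i
  proof -
    have "((\<lambda>y. a y * partial_deriv i u y) has_derivative
        (\<lambda>h. a x * frechet_derivative (partial_deriv i u) (at x) h +
          frechet_derivative a (at x) h * partial_deriv i u x)) (at x)"
      using a u[of i] by (intro has_derivative_mult) (simp_all add: frechet_derivative_works)
    then have "frechet_derivative (\<lambda>y. a y * partial_deriv i u y) (at x) =
        (\<lambda>h. a x * frechet_derivative (partial_deriv i u) (at x) h +
          frechet_derivative a (at x) h * partial_deriv i u x)"
      by (rule frechet_derivative_at[symmetric])
    then show ?thesis
      by (simp add: partial_deriv_def)
  qed
  then show ?thesis
    by (simp add: local_op_def sum.distrib sum_distrib_left)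
qed

section \<open>Geometry of the domain, the layer and the grid\<close>

lemma ball_subset_Un_layer:
  assumes "x \<in> \<Omega>"
  shows "ball x \<delta> \<subseteq> \<Omega> \<union> layer \<Omega> \<delta>"
proof
  fix y assume y: "y \<in> ball x \<delta>"
  show "y \<in> \<Omega> \<union> layer \<Omega> \<delta>"
  proof (cases "y \<in> \<Omega>")
    case False
    \<comment> \<open>A segment leaving \<Omega> crosses the frontier at a point no farther from y
      than x is.\<close>
    then obtain p where p: "p \<in> closed_segment x y" "p \<in> frontier \<Omega>"
      using connected_Int_frontier[of "closed_segment x y" \<Omega>] assms by auto
    have "infdist y (frontier \<Omega>) \<le> dist y p"
      using p(2) by (rule infdist_le)
    also have "\<dots> \<le> dist y x"
      using p(1) by (metis dist_commute dist_in_closed_segment)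
    also have "\<dots> < \<delta>"
      using y by (simp add: dist_commute)
    finally show ?thesis
      using False by (simp add: layer_def)
  qed simp
qed

lemma layer_mono: "\<delta> \<le> \<delta>' \<Longrightarrow> layer \<Omega> \<delta> \<subseteq> layer \<Omega> \<delta>'"
  by (auto simp: layer_def)

lemma closure_subset_Un_layer: "0 < \<delta> \<Longrightarrow> closure \<Omega> \<subseteq> \<Omega> \<union> layer \<Omega> \<delta>"
  using closure_Un_frontier[of \<Omega>] by (auto simp: layer_def)

lemma bounded_Un_layer:
  fixes \<Omega> :: "(real^'n::finite) set"
  assumes "bounded \<Omega>" "\<Omega> \<noteq> {}"
  obtains b where "\<And>y. y \<in> \<Omega> \<union> layer \<Omega> \<delta> \<Longrightarrow> norm y \<le> b"
proof -
  obtain c where c: "\<And>y. y \<in> closure \<Omega> \<Longrightarrow> norm y \<le> c"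
    using bounded_closure[OF assms(1)] by (auto simp: bounded_iff)
  \<comment> \<open>Distance to an empty set is 0 by convention, which would put every point outside
    \<Omega> into the layer when \<delta> > 0.\<close>
  have "frontier \<Omega> \<noteq> {}"
    using assms not_bounded_UNIV frontier_not_empty by metis
  have "norm y \<le> c + \<bar>\<delta>\<bar>" if y: "y \<in> \<Omega> \<union> layer \<Omega> \<delta>" for y
  proof (cases "y \<in> \<Omega>")
    case True
    then show ?thesis
      using c[of y] closure_subset[of \<Omega>] by auto
  next
    case False
    then have "infdist y (frontier \<Omega>) < \<delta>"
      using y by (simp add: layer_def)
    moreover obtain p where p: "p \<in> frontier \<Omega>" "infdist y (frontier \<Omega>) = dist y p"
      using infdist_attains_inf[OF frontier_closed \<open>frontier \<Omega> \<noteq> {}\<close>] by blast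
    ultimately have "norm (y - p) < \<delta>"
      by (simp add: dist_norm)
    moreover have "norm p \<le> c"
      using c[of p] p(1) by (simp add: frontier_def)
    ultimately show ?thesis
      using norm_triangle_sub[of y p] by simp
  qed
  then show thesis
    using that by blast
qed

lemma finite_grid:
  fixes \<Omega> :: "(real^'n::finite) set"
  assumes b: "\<And>y. y \<in> \<Omega> \<union> layer \<Omega> \<delta> \<Longrightarrow> norm y \<le> b" and h: "0 < h"
  shows "finite (grid \<Omega> \<delta> h)"
proof (rule finite_subset)
  define N where "N = \<lceil>b / h\<rceil>"
  show "grid \<Omega> \<delta> h \<subseteq> (\<lambda>k :: 'n \<Rightarrow> int. \<chi> i. of_int (k i) * h) ` (PiE UNIV (\<lambda>_. {- N..N}))"
  proof
    fix x assume x: "x \<in> grid \<Omega> \<delta> h"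
    then obtain k :: "'n \<Rightarrow> int" where k: "x = (\<chi> i. of_int (k i) * h)"
      by (auto simp: grid_def)
    have "\<bar>k i\<bar> \<le> N" for i
    proof -
      have "\<bar>of_int (k i) * h\<bar> \<le> b"
        using component_le_norm_cart[of x i] b[of x] x by (simp add: grid_def k)
      then have "of_int \<bar>k i\<bar> \<le> b / h"
        using h by (simp add: abs_mult field_simps)
      then show ?thesis
        unfolding N_def by linarith
    qed
    then have "k \<in> PiE UNIV (\<lambda>_. {- N..N})"
      by (auto simp: abs_le_iff) (metis minus_le_iff)
    then show "x \<in> (\<lambda>k :: 'n \<Rightarrow> int. \<chi> i. of_int (k i) * h) ` (PiE UNIV (\<lambda>_. {- N..N}))"
      using k by blast
  qed
  show "finite ((\<lambda>k. \<chi> i. of_int (k i) * h) ` (PiE UNIV (\<lambda>_. {- N..N})) :: (real^'n) set)"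
    by (intro finite_imageI finite_PiE) auto
qed

text \<open>Rounding p down to the lattice moves it by at most h per coordinate, hence by at most d
  h. Nonemptiness matters because \<open>grid_norm\<close> is a \<open>Max\<close>, which is
  meaningful on nonempty sets only.\<close>

lemma grid_nonempty:
  fixes \<Omega> :: "(real^'n::finite) set"
  assumes p: "ball p \<rho> \<subseteq> \<Omega>" and h: "0 < h" "real CARD('n) * h < \<rho>"
  shows "grid \<Omega> \<delta> h \<noteq> {}"
proof -
  define k where "k i = \<lfloor>p $ i / h\<rfloor>" for i
  define x :: "real^'n" where "x = (\<chi> i. of_int (k i) * h)"
  have "\<bar>(p - x) $ i\<bar> \<le> h" for i
  proof -
    have "of_int (k i) \<le> p $ i / h" "p $ i / h < of_int (k i) + 1"
      by (auto simp: k_def)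
    then show ?thesis
      using h by (simp add: x_def field_simps abs_le_iff)
  qed
  then have "norm (p - x) \<le> (\<Sum>i\<in>(UNIV :: 'n set). h)"
    by (intro order_trans[OF norm_le_l1_cart] sum_mono)
  then have "x \<in> \<Omega>"
    using p h by (auto simp: dist_norm)
  then have "x \<in> grid \<Omega> \<delta> h"
    by (auto simp: grid_def x_def)
  then show ?thesis
    by blast
qed

section \<open>The two operators as integrals against their measures\<close>

context power_kernel
begin

lemma nonlocal_op_eq_integral:
  fixes x :: "real^'n"
  assumes \<delta>: "0 < \<delta>" and cont: "continuous_on (ball x \<delta>) (A x)" "continuous_on (ball x \<delta>) v"
  shows "nonlocal_op A \<gamma>\<^sub>1 \<delta> v x = 2 * (\<integral>y. A x y * (v y - v x) \<partial>kernel_measure D\<^sub>0 s x \<delta>)"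
proof -
  have "continuous_on (ball x \<delta>) (\<lambda>y. A x y * (v y - v x))"
    using cont by (intro continuous_intros)
  then have "(\<lambda>y. A x y * (v y - v x)) \<in> borel_measurable (restrict_space lborel (ball x \<delta>))"
    by (rule measurable_kernel_measure(1))
  from integral_kernel_measure[OF this \<delta>] show ?thesis
    by (simp add: nonlocal_op_def mult_ac)
qed

lemma discrete_op_eq_integral:
  fixes x :: "real^'n"
  assumes "0 < \<delta>" "finite X" "\<And>y. y \<in> stencil X \<delta> x \<Longrightarrow> 0 \<le> \<omega> x y"
  shows "discrete_op A \<gamma>\<^sub>1 X \<delta> \<omega> v x =
     2 * (\<integral>y. A x y * (v y - v x) \<partial>quadrature_measure \<gamma>\<^sub>1 X \<delta> x (\<omega> x))"
  using integral_quadrature_measure[OF assms(1,2), of x "\<omega> x" "\<lambda>y. A x y * (v y - v x)"] assms(3)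
  by (simp add: discrete_op_def mult_ac)

end

theorem theorem3p8:
  fixes \<Omega> :: "(real^'n::finite) set"
    and \<gamma>\<^sub>1 :: "real \<Rightarrow> real" and D\<^sub>0 s :: real
    and A :: "real^'n \<Rightarrow> real^'n \<Rightarrow> real" and r R :: real
    and f u\<^sub>D u\<^sub>0 :: "real^'n \<Rightarrow> real"
    and u :: "real \<Rightarrow> real^'n \<Rightarrow> real"
    and \<delta>max Cpos :: real
  assumes domain: "Lipschitz_domain \<Omega>" "bounded \<Omega>"
    and \<delta>max: "0 < \<delta>max"
    and C1: "\<And>\<delta>. 0 < \<delta> \<Longrightarrow> \<delta> < \<delta>max \<Longrightarrow> C1_domain (\<Omega> \<union> layer \<Omega> \<delta>)"
    \<comment> \<open>kernel; its value at the origin is irrelevant\<close>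
    and D0: "0 < D\<^sub>0" and s: "s < real CARD('n)"
    and kernel_form: "\<And>t. 0 < t \<Longrightarrow> t < 1 \<Longrightarrow> \<gamma>\<^sub>1 t = D\<^sub>0 / t powr s"
    and kernel_supp: "\<And>t. 1 \<le> t \<Longrightarrow> \<gamma>\<^sub>1 t = 0"
    and kernel_nonneg: "\<And>t. 0 < t \<Longrightarrow> 0 \<le> \<gamma>\<^sub>1 t"
    and kernel_decr: "antimono_on {0<..} \<gamma>\<^sub>1"
    and kernel_normalized:
      "(LINT z:ball (0::real^'n) 1|lborel. \<gamma>\<^sub>1 (norm z) * (norm z)\<^sup>2) = real CARD('n)"
    \<comment> \<open>coefficient\<close>
    and A_sym: "\<And>\<delta> x y. 0 < \<delta> \<Longrightarrow> \<delta> < \<delta>max \<Longrightarrow> x \<in> \<Omega> \<union> layer \<Omega> \<delta> \<Longrightarrow>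
                  y \<in> \<Omega> \<union> layer \<Omega> \<delta> \<Longrightarrow> A x y = A y x"
    and A_cont: "\<And>\<delta>. 0 < \<delta> \<Longrightarrow> \<delta> < \<delta>max \<Longrightarrow>
                  continuous_on (closure ((\<Omega> \<union> layer \<Omega> \<delta>) \<times> (\<Omega> \<union> layer \<Omega> \<delta>))) (\<lambda>(x, y). A x y)"
    and r: "0 < r"
    and A_bounds: "\<And>\<delta> x y. 0 < \<delta> \<Longrightarrow> \<delta> < \<delta>max \<Longrightarrow> x \<in> \<Omega> \<union> layer \<Omega> \<delta> \<Longrightarrow>
                  y \<in> \<Omega> \<union> layer \<Omega> \<delta> \<Longrightarrow> r \<le> A x y \<and> A x y \<le> R"
    and A_C4: "\<And>\<delta>. 0 < \<delta> \<Longrightarrow> \<delta> < \<delta>max \<Longrightarrow>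
                  \<exists>M. \<forall>x \<in> \<Omega> \<union> layer \<Omega> \<delta>. Ck_bounded_on 4 (\<Omega> \<union> layer \<Omega> \<delta>) M (A x)"
    and a_smooth: "smooth_on \<Omega> (\<lambda>x. A x x)"
    \<comment> \<open>nonlocal problem\<close>
    and u_eq: "\<And>\<delta> x. 0 < \<delta> \<Longrightarrow> \<delta> < \<delta>max \<Longrightarrow> x \<in> \<Omega> \<Longrightarrow> - nonlocal_op A \<gamma>\<^sub>1 \<delta> (u \<delta>) x = f x"
    and u_bc: "\<And>\<delta> x. 0 < \<delta> \<Longrightarrow> \<delta> < \<delta>max \<Longrightarrow> x \<in> layer \<Omega> \<delta> \<Longrightarrow> u \<delta> x = u\<^sub>D x"
    and u_C4: "\<And>\<delta>. 0 < \<delta> \<Longrightarrow> \<delta> < \<delta>max \<Longrightarrow> \<exists>M. Ck_bounded_on 4 (\<Omega> \<union> layer \<Omega> \<delta>) M (u \<delta>)"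
    \<comment> \<open>local problem\<close>
    and u0_eq: "\<And>x. x \<in> \<Omega> \<Longrightarrow> - local_op (\<lambda>x. A x x) u\<^sub>0 x = f x"
    and u0_bc: "\<And>x. x \<in> frontier \<Omega> \<Longrightarrow> u\<^sub>0 x = u\<^sub>D x"
    and u0_ext: "\<And>\<delta> x. 0 < \<delta> \<Longrightarrow> \<delta> < \<delta>max \<Longrightarrow> x \<in> layer \<Omega> \<delta> \<Longrightarrow> u\<^sub>0 x = u\<^sub>D x"
    and u0_C4: "\<And>\<delta>. 0 < \<delta> \<Longrightarrow> \<delta> < \<delta>max \<Longrightarrow> \<exists>M. Ck_bounded_on 4 (\<Omega> \<union> layer \<Omega> \<delta>) M u\<^sub>0"
    \<comment> \<open>solvability of the weight optimization problem and positivity of the weights\<close>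
    and Cpos: "0 < Cpos"
    and weights_exist: "\<And>\<delta> h x. 0 < \<delta> \<Longrightarrow> \<delta> < \<delta>max \<Longrightarrow> 0 < h \<Longrightarrow> h < Cpos * \<delta> \<Longrightarrow>
                  x \<in> grid \<Omega> \<delta> h \<inter> \<Omega> \<Longrightarrow> \<exists>w. quadrature_weights \<gamma>\<^sub>1 (grid \<Omega> \<delta> h) \<delta> x w"
    and weights_pos: "\<And>\<delta> h x w y. 0 < \<delta> \<Longrightarrow> \<delta> < \<delta>max \<Longrightarrow> 0 < h \<Longrightarrow> h < Cpos * \<delta> \<Longrightarrow>
                  x \<in> grid \<Omega> \<delta> h \<inter> \<Omega> \<Longrightarrow> quadrature_weights \<gamma>\<^sub>1 (grid \<Omega> \<delta> h) \<delta> x w \<Longrightarrow>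
                  y \<in> stencil (grid \<Omega> \<delta> h) \<delta> x \<Longrightarrow> 0 < w y"
  shows "\<exists>\<delta>\<^sub>0>0. \<forall>\<kappa>. 0 < \<kappa> \<and> \<kappa> < Cpos \<longrightarrow>
           (\<exists>C. \<forall>\<delta> h. 0 < \<delta> \<and> \<delta> < \<delta>\<^sub>0 \<and> h / \<delta> = \<kappa> \<longrightarrow>
             (\<forall>\<omega> uh.
                (\<forall>x \<in> grid \<Omega> \<delta> h \<inter> \<Omega>. quadrature_weights \<gamma>\<^sub>1 (grid \<Omega> \<delta> h) \<delta> x (\<omega> x)) \<and>
                (\<forall>x \<in> grid \<Omega> \<delta> h \<inter> \<Omega>. - discrete_op A \<gamma>\<^sub>1 (grid \<Omega> \<delta> h) \<delta> \<omega> uh x = f x) \<and>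
                (\<forall>x \<in> grid \<Omega> \<delta> h \<inter> layer \<Omega> \<delta>. uh x = u\<^sub>D x) \<longrightarrow>
                grid_norm (grid \<Omega> \<delta> h) (\<lambda>x. uh x - u \<delta> x) \<le> C * \<delta>\<^sup>2 \<and>
                grid_norm (grid \<Omega> \<delta> h) (\<lambda>x. uh x - u\<^sub>0 x) \<le> C * \<delta>\<^sup>2))"
proof -
  interpret K: power_kernel \<gamma>\<^sub>1 D\<^sub>0 s "TYPE('n)"
    by unfold_locales (fact D0 s kernel_form kernel_normalized)+
  define d where "d = real CARD('n)"
  define V where "V \<delta> = \<Omega> \<union> layer \<Omega> \<delta>" for \<delta>
  \<comment> \<open>One fixed admissible width: smaller layers lie inside this one, so bounds
    obtained here do not depend on \<delta>.\<close>
  define \<delta>\<^sub>1 where "\<delta>\<^sub>1 = \<delta>max / 2"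
  have \<delta>\<^sub>1: "0 < \<delta>\<^sub>1" "\<delta>\<^sub>1 < \<delta>max"
    using \<delta>max by (auto simp: \<delta>\<^sub>1_def)
  have "open \<Omega>" "\<Omega> \<noteq> {}"
    using domain by (auto simp: Lipschitz_domain_def graph_domain_def)
  have "open (V \<delta>\<^sub>1)"
    using C1[OF \<delta>\<^sub>1] by (auto simp: C1_domain_def graph_domain_def V_def)
  have V_mono: "V \<delta> \<subseteq> V \<delta>\<^sub>1" if "\<delta> \<le> \<delta>\<^sub>1" for \<delta>
    using layer_mono[OF that, of \<Omega>] by (auto simp: V_def)
  have ball_V: "ball x \<delta> \<subseteq> V \<delta>" if "x \<in> \<Omega>" for x \<delta>
    unfolding V_def using that by (rule ball_subset_Un_layer)
  obtain M where M: "\<And>x. x \<in> V \<delta>\<^sub>1 \<Longrightarrow> Ck_bounded_on 4 (V \<delta>\<^sub>1) M (A x)"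
    using A_C4[OF \<delta>\<^sub>1] unfolding V_def by blast
  obtain N where N: "Ck_bounded_on 4 (V \<delta>\<^sub>1) N u\<^sub>0"
    using u0_C4[OF \<delta>\<^sub>1] unfolding V_def by blast
  obtain b where b: "\<And>y. y \<in> V \<delta>\<^sub>1 \<Longrightarrow> norm y \<le> b"
    using bounded_Un_layer[OF domain(2) \<open>\<Omega> \<noteq> {}\<close>] unfolding V_def by blast
  obtain p \<rho> where "0 < \<rho>" and p: "ball p \<rho> \<subseteq> \<Omega>"
    using \<open>open \<Omega>\<close> \<open>\<Omega> \<noteq> {}\<close> openE by blast
  \<comment> \<open>The barrier may grow along any coordinate axis.\<close>
  define i :: 'n where "i = undefined"
  \<comment> \<open>Solved from the barrier's requirement 1 + d^2 M \<le> r l / 6.\<close>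
  define l where "l = max 1 (6 * (1 + d\<^sup>2 * M) / r)"
  have l: "1 \<le> l" "1 + (real CARD('n))\<^sup>2 * M \<le> r * l / 6"
  proof -
    have "6 * (1 + d\<^sup>2 * M) / r \<le> l"
      by (simp add: l_def)
    then show "1 + (real CARD('n))\<^sup>2 * M \<le> r * l / 6"
      using r by (simp add: d_def field_simps)
  qed (simp add: l_def)
  define K where "K = 8 * d ^ 5 * M * N"
  obtain x\<^sub>0 where "x\<^sub>0 \<in> V \<delta>\<^sub>1"
    using \<open>\<Omega> \<noteq> {}\<close> by (auto simp: V_def)
  then have "0 \<le> M" "0 \<le> N"
    using Ck_bounded_onD(3)[OF M, of x\<^sub>0 "[]" x\<^sub>0] Ck_bounded_onD(3)[OF N, of "[]" x\<^sub>0] by auto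
  then have "0 \<le> K"
    by (simp add: K_def d_def)
  \<comment> \<open>Consistency error times the height of the barrier; K + 1 instead of K keeps the
    defect bound strictly positive, as the maximum principle demands.\<close>
  define C where "C = (K + 1) * exp (2 * l * b)"
  have "0 \<le> C"
    using \<open>0 \<le> K\<close> by (simp add: C_def)
  \<comment> \<open>The bound 1/l keeps the exponents of the barrier within [-1, 1]; the bound
    \<rho> / (d Cpos) gives d h < \<rho>, so that a grid point falls into the inscribed
    ball.\<close>
  define \<delta>\<^sub>0 where "\<delta>\<^sub>0 = min \<delta>\<^sub>1 (min (1 / l) (\<rho> / (d * Cpos)))"
  have "0 < d"
    by (simp add: d_def)
  have "0 < \<delta>\<^sub>0"
    using \<delta>\<^sub>1 l \<open>0 < \<rho>\<close> Cpos \<open>0 < d\<close> by (simp add: \<delta>\<^sub>0_def)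

  have local: "f x = - (A x x * (\<Sum>i\<in>UNIV. iter_deriv [i, i] u\<^sub>0 x) +
      2 * (\<Sum>i\<in>UNIV. partial_deriv i (A x) x * partial_deriv i u\<^sub>0 x))" if x: "x \<in> \<Omega>" for x
  proof -
    have xV: "x \<in> V \<delta>\<^sub>1"
      using x by (simp add: V_def)
    have diff: "(\<lambda>y. A y y) differentiable (at x)"
    proof -
      have "Ck_on 1 \<Omega> (\<lambda>y. A y y)"
        using a_smooth by (simp add: smooth_on_def)
      then show ?thesis
        using x by (auto simp: Ck_on_def)
    qed
    have "(\<Omega> \<union> layer \<Omega> \<delta>\<^sub>1) \<times> (\<Omega> \<union> layer \<Omega> \<delta>\<^sub>1) \<subseteq> closure ((\<Omega> \<union> layer \<Omega> \<delta>\<^sub>1) \<times> (\<Omega> \<union> layer \<Omega> \<delta>\<^sub>1))"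
      by (rule closure_subset)
    then have cont: "continuous_on (V \<delta>\<^sub>1 \<times> V \<delta>\<^sub>1) (\<lambda>(y, z). A y z)"
      unfolding V_def by (rule continuous_on_subset[OF A_cont[OF \<delta>\<^sub>1]])
    have "partial_deriv i (\<lambda>y. A y y) x = 2 * partial_deriv i (A x) x" for i
    proof (rule partial_deriv_diagonal[OF \<open>open (V \<delta>\<^sub>1)\<close> xV _ cont _ diff])
      show "A y z = A z y" if "y \<in> V \<delta>\<^sub>1" "z \<in> V \<delta>\<^sub>1" for y z
        using A_sym[OF \<delta>\<^sub>1] that by (simp add: V_def)
      show "Ck_bounded_on 2 (V \<delta>\<^sub>1) M (A y)" if "y \<in> V \<delta>\<^sub>1" for y
        using M[OF that] by (rule Ck_bounded_on_le) simp
    qed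
    moreover have "partial_deriv i u\<^sub>0 differentiable (at x)" for i
      using Ck_bounded_onD(1)[OF N, of "[i]"] xV by simp
    ultimately show ?thesis
      using u0_eq[OF x] local_op_expand[OF diff, of u\<^sub>0]
      by (simp add: sum_distrib_left mult.assoc)
  qed

  \<comment> \<open>Shared by both comparisons: \<open>v\<close> is \<open>uh\<close> on the grid or
    \<open>u \<delta>\<close> on \<open>V \<delta>\<close>. As \<open>v\<close> solves its equation
    exactly, the defect of v - \<open>u\<^sub>0\<close> is the consistency error of
    \<open>u\<^sub>0\<close> alone.\<close>
  have stable: "\<bar>v y - u\<^sub>0 y\<bar> \<le> C * \<delta>\<^sup>2"
    if \<delta>: "0 < \<delta>" "\<delta> < \<delta>\<^sub>0" and Y: "Y \<subseteq> V \<delta>" "compact (Y \<inter> closure \<Omega>)"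
      and v: "continuous_on (Y \<inter> closure \<Omega>) v" "\<And>y. y \<in> Y \<inter> layer \<Omega> \<delta> \<Longrightarrow> v y = u\<^sub>D y"
      and \<mu>: "\<And>x. x \<in> Y \<inter> \<Omega> \<Longrightarrow> isotropic_measure (\<mu> x) x \<delta>" "\<And>x. x \<in> Y \<inter> \<Omega> \<Longrightarrow> space (\<mu> x) \<subseteq> Y"
      and int: "\<And>x. x \<in> Y \<inter> \<Omega> \<Longrightarrow> integrable (\<mu> x) (\<lambda>y. A x y * (v y - v x))"
      and eq: "\<And>x. x \<in> Y \<inter> \<Omega> \<Longrightarrow> - (2 * (\<integral>y. A x y * (v y - v x) \<partial>\<mu> x)) = f x"
      and y: "y \<in> Y"
    for \<delta> Y v \<mu> y
  proof -
    have \<delta>': "\<delta> \<le> \<delta>\<^sub>1" "\<delta> < \<delta>max" "l * \<delta> \<le> 1"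
      using \<delta> \<delta>\<^sub>1 l(1) by (auto simp: \<delta>\<^sub>0_def field_simps)
    have ballV: "ball x \<delta> \<subseteq> V \<delta>\<^sub>1" if "x \<in> \<Omega>" for x
      using ball_V[OF that] V_mono[OF \<delta>'(1)] by blast
    have A_ball: "Ck_bounded_on 4 (ball x \<delta>) M (A x)" if "x \<in> \<Omega>" for x
      using M[of x] ballV[OF that] that by (intro Ck_bounded_on_subset[OF M]) (auto simp: V_def)
    have u\<^sub>0_ball: "Ck_bounded_on 4 (ball x \<delta>) N u\<^sub>0" if "x \<in> \<Omega>" for x
      using N ballV[OF that] by (rule Ck_bounded_on_subset)
    have u\<^sub>0_int: "integrable (\<mu> x) (\<lambda>y. A x y * (u\<^sub>0 y - u\<^sub>0 x))" if x: "x \<in> Y \<inter> \<Omega>" for x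
    proof -
      interpret isotropic_measure "\<mu> x" x \<delta>
        using \<mu>(1)[OF x] .
      have x\<Omega>: "x \<in> \<Omega>"
        using x by simp
      show ?thesis
        using Ck_bounded_onD(2,3)[OF A_ball[OF x\<Omega>], of "[]"] Ck_bounded_onD(2,3)[OF u\<^sub>0_ball[OF x\<Omega>], of "[]"]
        by (intro integrable_increment[of "A x" M u\<^sub>0 N]) auto
    qed
    have diff: "A x y * ((v y - u\<^sub>0 y) - (v x - u\<^sub>0 x)) =
        A x y * (v y - v x) - A x y * (u\<^sub>0 y - u\<^sub>0 x)" for x y
      by (simp add: algebra_simps)
    have le: "\<bar>2 * (\<integral>y. A x y * ((v y - u\<^sub>0 y) - (v x - u\<^sub>0 x)) \<partial>\<mu> x)\<bar> \<le> (K + 1) * \<delta>\<^sup>2"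
      if x: "x \<in> Y \<inter> \<Omega>" for x
    proof -
      interpret isotropic_measure "\<mu> x" x \<delta>
        using \<mu>(1)[OF x] .
      have x\<Omega>: "x \<in> \<Omega>"
        using x by simp
      have "\<bar>2 * (\<integral>y. A x y * (u\<^sub>0 y - u\<^sub>0 x) \<partial>\<mu> x) + f x\<bar> \<le> K * \<delta>\<^sup>2"
        using consistency[OF Ck_bounded_on_le[OF A_ball[OF x\<Omega>]] u\<^sub>0_ball[OF x\<Omega>]] local[OF x\<Omega>]
        by (simp add: K_def d_def)
      moreover have "(\<integral>y. A x y * ((v y - u\<^sub>0 y) - (v x - u\<^sub>0 x)) \<partial>\<mu> x) =
          (\<integral>y. A x y * (v y - v x) \<partial>\<mu> x) - (\<integral>y. A x y * (u\<^sub>0 y - u\<^sub>0 x) \<partial>\<mu> x)"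
        unfolding diff using int[OF x] u\<^sub>0_int[OF x] by (rule Bochner_Integration.integral_diff)
      moreover have "K * \<delta>\<^sup>2 \<le> (K + 1) * \<delta>\<^sup>2"
        by (intro mult_right_mono) auto
      ultimately show ?thesis
        using eq[OF x] by linarith
    qed
    have "\<bar>v y - u\<^sub>0 y\<bar> \<le> ((K + 1) * \<delta>\<^sup>2) * exp (2 * l * b)"
    proof (rule nonlocal_stability[where e = "\<lambda>y. v y - u\<^sub>0 y" and A = A and \<mu> = \<mu> and M = M
          and i = i and y = y and Y = Y and \<Omega> = \<Omega> and \<delta> = \<delta> and r = r and l = l and b = b
          and \<eta> = "(K + 1) * \<delta>\<^sup>2"])
      show "isotropic_measure (\<mu> x) x \<delta>" "space (\<mu> x) \<subseteq> Y" if "x \<in> Y \<inter> \<Omega>" for x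
        using \<mu>[OF that] by auto
      show "\<bar>2 * (\<integral>y. A x y * (v y - u\<^sub>0 y - (v x - u\<^sub>0 x)) \<partial>\<mu> x)\<bar> \<le> (K + 1) * \<delta>\<^sup>2"
        if "x \<in> Y \<inter> \<Omega>" for x
        using le[OF that] .
      show "continuous_on (Y \<inter> closure \<Omega>) (\<lambda>y. v y - u\<^sub>0 y)"
      proof (rule continuous_on_diff[OF v(1)])
        have "continuous_on (V \<delta>\<^sub>1) u\<^sub>0"
          using Ck_bounded_onD(2)[OF N, of "[]"] by simp
        then show "continuous_on (Y \<inter> closure \<Omega>) u\<^sub>0"
          by (rule continuous_on_subset) (use Y(1) V_mono[OF \<delta>'(1)] in auto)
      qed
      show "Ck_bounded_on 1 (ball x \<delta>) M (A x)" if "x \<in> Y \<inter> \<Omega>" for x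
        using that by (intro Ck_bounded_on_le[OF A_ball]) auto
      show "r \<le> A x y" if "x \<in> Y \<inter> \<Omega>" "y \<in> ball x \<delta>" for x y
        using A_bounds[OF \<delta>\<^sub>1, of x y] ballV[of x] that by (auto simp: V_def)
      show "\<bar>y $ i\<bar> \<le> b" if "y \<in> Y" for y
        using order_trans[OF component_le_norm_cart b] that Y(1) V_mono[OF \<delta>'(1)] by blast
      show "v y - u\<^sub>0 y = 0" if "y \<in> Y - \<Omega>" for y
        using that Y(1) v(2)[of y] u0_ext[OF \<delta>(1) \<delta>'(2), of y] by (auto simp: V_def)
      show "integrable (\<mu> x) (\<lambda>y. A x y * (v y - u\<^sub>0 y - (v x - u\<^sub>0 x)))" if "x \<in> Y \<inter> \<Omega>" for x
        unfolding diff using int[OF that] u\<^sub>0_int[OF that] by (rule Bochner_Integration.integrable_diff)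
      show "0 < (K + 1) * \<delta>\<^sup>2"
        using \<open>0 \<le> K\<close> \<delta> by simp
    qed (fact Y(2) r l \<delta>'(3) y)+
    then show ?thesis
      by (simp add: C_def mult_ac)
  qed

  \<comment> \<open>The constant depends neither on h nor on the ratio, so the same one can be given
    for every \<kappa>.\<close>
  have bound: "grid_norm (grid \<Omega> \<delta> h) (\<lambda>x. uh x - u \<delta> x) \<le> 2 * C * \<delta>\<^sup>2 \<and>
      grid_norm (grid \<Omega> \<delta> h) (\<lambda>x. uh x - u\<^sub>0 x) \<le> 2 * C * \<delta>\<^sup>2"
    if \<delta>: "0 < \<delta>" "\<delta> < \<delta>\<^sub>0" and h: "0 < h" "h < Cpos * \<delta>"
      and \<omega>: "\<And>x. x \<in> grid \<Omega> \<delta> h \<inter> \<Omega> \<Longrightarrow> quadrature_weights \<gamma>\<^sub>1 (grid \<Omega> \<delta> h) \<delta> x (\<omega> x)"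
      and uh: "\<And>x. x \<in> grid \<Omega> \<delta> h \<inter> \<Omega> \<Longrightarrow> - discrete_op A \<gamma>\<^sub>1 (grid \<Omega> \<delta> h) \<delta> \<omega> uh x = f x"
      and bc: "\<And>x. x \<in> grid \<Omega> \<delta> h \<inter> layer \<Omega> \<delta> \<Longrightarrow> uh x = u\<^sub>D x"
    for \<delta> h \<omega> uh
  proof -
    let ?X = "grid \<Omega> \<delta> h"
    have \<delta>': "\<delta> \<le> \<delta>\<^sub>1" "\<delta> < \<delta>max"
      using \<delta> \<delta>\<^sub>1 by (auto simp: \<delta>\<^sub>0_def)
    have X: "?X \<subseteq> V \<delta>"
      by (auto simp: grid_def V_def)
    have fin: "finite ?X"
      using b V_mono[OF \<delta>'(1)] h(1) by (intro finite_grid[of _ _ b]) (auto simp: V_def)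
    have "d * Cpos * \<delta> < \<rho>"
      using \<delta>(2) Cpos \<open>0 < d\<close> by (simp add: \<delta>\<^sub>0_def field_simps)
    moreover have "d * h \<le> d * (Cpos * \<delta>)"
      using h \<open>0 < d\<close> by simp
    ultimately have "real CARD('n) * h < \<rho>"
      by (simp only: d_def mult.assoc)
    then have "?X \<noteq> {}"
      using h(1) p by (intro grid_nonempty)

    have pos: "0 \<le> \<omega> x y" if "x \<in> ?X \<inter> \<Omega>" "y \<in> stencil ?X \<delta> x" for x y
      using weights_pos[OF \<delta>(1) \<delta>'(2) h that(1) \<omega>[OF that(1)] that(2)] by simp
    have discrete: "\<bar>uh y - u\<^sub>0 y\<bar> \<le> C * \<delta>\<^sup>2" if "y \<in> ?X" for y
    proof (rule stable[OF \<delta> X, where v = uh and y = y and \<mu> = "\<lambda>x. quadrature_measure \<gamma>\<^sub>1 ?X \<delta> x (\<omega> x)"])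
      show "compact (?X \<inter> closure \<Omega>)" "continuous_on (?X \<inter> closure \<Omega>) uh"
        using fin by (auto intro!: finite_imp_compact continuous_on_finite)
      fix x assume x: "x \<in> ?X \<inter> \<Omega>"
      show "isotropic_measure (quadrature_measure \<gamma>\<^sub>1 ?X \<delta> x (\<omega> x)) x \<delta>"
        using \<delta>(1) fin pos[OF x] \<omega>[OF x] unfolding quadrature_weights_def
        by (intro K.isotropic_quadrature_measure) auto
      show "space (quadrature_measure \<gamma>\<^sub>1 ?X \<delta> x (\<omega> x)) \<subseteq> ?X"
        by (auto simp: quadrature_measure_def space_point_measure stencil_def)
      show "integrable (quadrature_measure \<gamma>\<^sub>1 ?X \<delta> x (\<omega> x)) (\<lambda>y. A x y * (uh y - uh x))"
        using \<delta>(1) fin pos[OF x] by (rule K.integrable_quadrature_measure)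
      show "- (2 * (\<integral>y. A x y * (uh y - uh x) \<partial>quadrature_measure \<gamma>\<^sub>1 ?X \<delta> x (\<omega> x))) = f x"
        using uh[OF x] K.discrete_op_eq_integral[where \<omega> = \<omega> and A = A and v = uh, OF \<delta>(1) fin pos[OF x]] by simp
    qed (use bc that in auto)

    \<comment> \<open>\<open>N'\<close> may depend on \<delta>: it serves integrability only and
      does not enter the error bound.\<close>
    obtain N' where N': "Ck_bounded_on 4 (V \<delta>) N' (u \<delta>)"
      using u_C4[OF \<delta>(1) \<delta>'(2)] unfolding V_def by blast
    have continuous: "\<bar>u \<delta> y - u\<^sub>0 y\<bar> \<le> C * \<delta>\<^sup>2" if "y \<in> V \<delta>" for y
    proof (rule stable[OF \<delta>, where v = "u \<delta>" and y = y and \<mu> = "\<lambda>x. kernel_measure D\<^sub>0 s x \<delta>" and Y = "V \<delta>"])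
      have closure: "closure \<Omega> \<subseteq> V \<delta>"
        unfolding V_def using \<delta>(1) by (rule closure_subset_Un_layer)
      then show "compact (V \<delta> \<inter> closure \<Omega>)"
        using domain(2) by (simp add: Int_absorb1 compact_closure)
      show "continuous_on (V \<delta> \<inter> closure \<Omega>) (u \<delta>)"
        using Ck_bounded_onD(2)[OF N', of "[]"] by (auto intro: continuous_on_subset)
      show "u \<delta> y = u\<^sub>D y" if "y \<in> V \<delta> \<inter> layer \<Omega> \<delta>" for y
        using u_bc[OF \<delta>(1) \<delta>'(2)] that by simp
      fix x assume x: "x \<in> V \<delta> \<inter> \<Omega>"
      then have ball: "ball x \<delta> \<subseteq> V \<delta>" and "x \<in> V \<delta>\<^sub>1"
        using ball_V[of x \<delta>] by (auto simp: V_def)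
      have A_ball: "Ck_bounded_on 4 (ball x \<delta>) M (A x)"
        using ball V_mono[OF \<delta>'(1)]
        by (intro Ck_bounded_on_subset[OF M[OF \<open>x \<in> V \<delta>\<^sub>1\<close>]]) auto
      have u_ball: "Ck_bounded_on 4 (ball x \<delta>) N' (u \<delta>)"
        using N' ball by (rule Ck_bounded_on_subset)
      show iso: "isotropic_measure (kernel_measure D\<^sub>0 s x \<delta>) x \<delta>"
        using \<delta>(1) by (rule K.isotropic_kernel_measure)
      show "space (kernel_measure D\<^sub>0 s x \<delta>) \<subseteq> V \<delta>"
        using isotropic_measure.space_subset[OF iso] ball by blast
      show "integrable (kernel_measure D\<^sub>0 s x \<delta>) (\<lambda>y. A x y * (u \<delta> y - u \<delta> x))"
        using Ck_bounded_onD(2,3)[OF A_ball, of "[]"] Ck_bounded_onD(2,3)[OF u_ball, of "[]"]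
        by (intro isotropic_measure.integrable_increment[OF iso, of "A x" M "u \<delta>" N']) auto
      show "- (2 * (\<integral>y. A x y * (u \<delta> y - u \<delta> x) \<partial>kernel_measure D\<^sub>0 s x \<delta>)) = f x"
        using u_eq[OF \<delta>(1) \<delta>'(2), of x] x K.nonlocal_op_eq_integral[where A = A and v = "u \<delta>" and x = x, OF \<delta>(1)]
          Ck_bounded_onD(2)[OF A_ball, of "[]"] Ck_bounded_onD(2)[OF u_ball, of "[]"] by simp
    qed (use that in auto)

    have "0 \<le> C * \<delta>\<^sup>2"
      using \<open>0 \<le> C\<close> by simp
    \<comment> \<open>The triangle inequality through \<open>u\<^sub>0\<close> accounts for the
      factor 2.\<close>
    have "\<bar>uh y - u \<delta> y\<bar> \<le> 2 * C * \<delta>\<^sup>2 \<and> \<bar>uh y - u\<^sub>0 y\<bar> \<le> 2 * C * \<delta>\<^sup>2" if "y \<in> ?X" for y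
      using discrete[OF that] continuous[of y] that X \<open>0 \<le> C * \<delta>\<^sup>2\<close> by auto
    then show ?thesis
      using fin \<open>?X \<noteq> {}\<close> by (auto simp: grid_norm_def)
  qed
  show ?thesis
  proof (rule exI[of _ \<delta>\<^sub>0], intro conjI allI impI exI[of _ "2 * C"])
    show "0 < \<delta>\<^sub>0"
      by fact
  next
    fix \<kappa> \<delta> h \<omega> uh
    assume \<kappa>: "0 < \<kappa> \<and> \<kappa> < Cpos" and \<delta>: "0 < \<delta> \<and> \<delta> < \<delta>\<^sub>0 \<and> h / \<delta> = \<kappa>"
      and scheme: "(\<forall>x \<in> grid \<Omega> \<delta> h \<inter> \<Omega>. quadrature_weights \<gamma>\<^sub>1 (grid \<Omega> \<delta> h) \<delta> x (\<omega> x)) \<and>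
        (\<forall>x \<in> grid \<Omega> \<delta> h \<inter> \<Omega>. - discrete_op A \<gamma>\<^sub>1 (grid \<Omega> \<delta> h) \<delta> \<omega> uh x = f x) \<and>
        (\<forall>x \<in> grid \<Omega> \<delta> h \<inter> layer \<Omega> \<delta>. uh x = u\<^sub>D x)"
    have "h = \<kappa> * \<delta>"
      using \<delta> by auto
    then have "0 < h" "h < Cpos * \<delta>"
      using \<kappa> \<delta> by auto
    then show "grid_norm (grid \<Omega> \<delta> h) (\<lambda>x. uh x - u \<delta> x) \<le> 2 * C * \<delta>\<^sup>2"
      "grid_norm (grid \<Omega> \<delta> h) (\<lambda>x. uh x - u\<^sub>0 x) \<le> 2 * C * \<delta>\<^sup>2"
      using bound[of \<delta> h \<omega> uh] \<delta> scheme by blast+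
  qed
qed

end
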